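(* Let $\beta\colon(0,\infty)\to(0,\infty)$ be a continuous, increasing function for which there is $x_0$ such that $\beta(x)>x$ for all $x>x_0$. Let $f$ be a transcendental entire function and let $$A=\left\{z\in\mathbb{C}\colon \operatorname{Re}\!\left(\frac{zf'(z)}{f(z)}\right)>64\ \text{ and }\ |f(z)|>\beta(|z|)\right\}$$ and $$B=\left\{z\in A\colon \operatorname{Re}\!\left(\frac{\zeta f'(\zeta)}{f(\zeta)}\right)>0\ \text{ for all } \zeta \text{ with } |\zeta-z|<32\left|\frac{f(z)}{f'(z)}\right|\right\}.$$ Let $\alpha\colon(0,\infty)\to(0,\infty)$ be a continuous, decreasing function which satisfies $\alpha(r)\to0$ as $r\to\infty$ and $$\sum_{n=0}^\infty\alpha(\beta^n(r_0))<\infty$$ for some $r_0>0$. Suppose that $$\operatorname{dens}\bigl(B,\{z\colon r/2<|z|<2r\}\bigr)\geq 1-\alpha(r)$$ for all large $r$. Then $I(f)$ has positive Lebesgue measure. Moreover, if $f$ does not have multiply-connected wandering domains, then $I(f)\cap J(f)$ has positive Lebesgue measure.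
   Context: $\beta^n$ denotes the $n$-th iterate of $\beta$. For measurable $X,Y\subset\mathbb{C}$ with $Y$ of non-zero Lebesgue measure, $\operatorname{dens}(X,Y)=\operatorname{meas}(X\cap Y)/\operatorname{meas}(Y)$, where $\operatorname{meas}$ is two-dimensional Lebesgue measure. The conditions on $zf'(z)/f(z)$ in the definitions of $A$ and $B$ include that the quotient is defined, i.e. that $f$ does not vanish at the point in question. For an entire function $f$, the Fatou set is the set of points of $\mathbb{C}$ at which the iterates $f^n$ form a normal family, the Julia set $J(f)$ is its complement in $\mathbb{C}$, and the escaping set is $I(f)=\{z\in\mathbb{C}\colon f^n(z)\to\infty\text{ as }n\to\infty\}$. A wandering domain is a connected component $U$ of the Fatou set such that $f^n(U)\cap f^k(U)=\emptyset$ for all $n\neq k$. *)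

theory Defs
  imports "HOL-Complex_Analysis.Complex_Analysis"
begin

definition transcendental_entire :: "(complex \<Rightarrow> complex) \<Rightarrow> bool" where
  "transcendental_entire f \<longleftrightarrow>
     f holomorphic_on UNIV \<and> \<not> (\<exists>p. \<forall>z. f z = poly p z)"

text \<open>
  Normality with respect to the Riemann sphere: the locally uniform limit of a subsequence may
  also be the constant \<open>\<infinity>\<close>. By Hurwitz's theorem a spherical limit of holomorphic functions on a
  connected set is either holomorphic or identically \<open>\<infinity>\<close>, so on domains \<open>U\<close> no other
  limits occur.
\<close>

definition normal_family_on :: "complex set \<Rightarrow> (complex \<Rightarrow> complex) set \<Rightarrow> bool" where
  "normal_family_on U F \<longleftrightarrow>
     (\<forall>g :: nat \<Rightarrow> complex \<Rightarrow> complex. range g \<subseteq> F \<longrightarrow>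
        (\<exists>s :: nat \<Rightarrow> nat. strict_mono s \<and>
           ((\<exists>h. h holomorphic_on U \<and>
                 (\<forall>K. compact K \<and> K \<subseteq> U \<longrightarrow>
                    uniform_limit K (\<lambda>n. g (s n)) h sequentially)) \<or>
            (\<forall>K. compact K \<and> K \<subseteq> U \<longrightarrow>
               (\<forall>M. \<forall>\<^sub>F n in sequentially. \<forall>z\<in>K. norm (g (s n) z) > M)))))"

definition fatou_set :: "(complex \<Rightarrow> complex) \<Rightarrow> complex set" where
  "fatou_set f =
     {z. \<exists>U. open U \<and> connected U \<and> z \<in> U \<and> normal_family_on U (range (\<lambda>n. f ^^ n))}"

definition julia_set :: "(complex \<Rightarrow> complex) \<Rightarrow> complex set" where
  "julia_set f = - fatou_set f"

definition escaping_set :: "(complex \<Rightarrow> complex) \<Rightarrow> complex set" where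
  "escaping_set f = {z. filterlim (\<lambda>n. (f ^^ n) z) at_infinity sequentially}"

definition wandering_domain :: "(complex \<Rightarrow> complex) \<Rightarrow> complex set \<Rightarrow> bool" where
  "wandering_domain f U \<longleftrightarrow>
     U \<in> components (fatou_set f) \<and>
     (\<forall>n k. n \<noteq> k \<longrightarrow> (f ^^ n) ` U \<inter> (f ^^ k) ` U = {})"

definition multiply_connected :: "complex set \<Rightarrow> bool" where
  "multiply_connected U \<longleftrightarrow> connected U \<and> \<not> simply_connected U"

text \<open>
  Intended for \<open>Y\<close> of finite nonzero measure: \<^const>\<open>measure\<close> is \<open>0\<close> on sets of
  infinite measure.
\<close>

definition dens :: "complex set \<Rightarrow> complex set \<Rightarrow> real" where
  "dens X Y = measure lebesgue (X \<inter> Y) / measure lebesgue Y"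

definition set_A :: "(real \<Rightarrow> real) \<Rightarrow> (complex \<Rightarrow> complex) \<Rightarrow> complex set" where
  "set_A \<beta> f =
     {z. f z \<noteq> 0 \<and> Re (z * deriv f z / f z) > 64 \<and> norm (f z) > \<beta> (norm z)}"

text \<open>
  For \<open>z \<in> set_A \<beta> f\<close> the derivative does not vanish at \<open>z\<close>, so the radius below is
  a genuine quotient. Also \<open>z \<noteq> 0\<close>, so \<open>\<beta>\<close> is only relevant on the positive reals.
\<close>

definition set_B :: "(real \<Rightarrow> real) \<Rightarrow> (complex \<Rightarrow> complex) \<Rightarrow> complex set" where
  "set_B \<beta> f =
     {z \<in> set_A \<beta> f. \<forall>\<zeta>. norm (\<zeta> - z) < 32 * norm (f z / deriv f z) \<longrightarrow>
        f \<zeta> \<noteq> 0 \<and> Re (\<zeta> * deriv f \<zeta> / f \<zeta>) > 0}"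

end

theory Submission
  imports Defs
begin

text \<open>
Write \<open>B\<close> for \<open>set_B \<beta> f\<close>. The points to be found are those whose whole forward orbit stays
in \<open>B\<close>: since \<open>\<bar>f z\<bar> > \<beta> \<bar>z\<bar>\<close> on \<open>B\<close>, such an orbit dominates an orbit of \<open>\<beta>\<close>, and
the summability of \<open>\<alpha>\<close> along an orbit of \<open>\<beta>\<close> forces the latter to tend to infinity.

Near a point \<open>z\<close> of \<open>B\<close> the function \<open>\<zeta> f'(\<zeta>) / f(\<zeta>)\<close> has positive real part on a
disk of radius \<open>32 \<bar>f z / f' z\<bar>\<close>. The Schwarz lemma for maps into a half plane then bounds the
variation of the derivative of a branch \<open>L\<close> of \<open>log f\<close>. This has two consequences.
On a small disk around \<open>z\<close> the map \<open>f\<close> is close to its affine approximation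
(\<open>set_B_step\<close>). And \<open>L\<close> covers a disk of radius \<open>4 > \<pi>\<close> around \<open>L z\<close>
(\<open>set_B_cover\<close>), so that \<open>f\<close> covers the whole circle through \<open>f z\<close> around \<open>0\<close>. Because
\<open>\<bar>z f' z / f z\<bar> > 64\<close> on \<open>B\<close>, disks around a point of the orbit shrink geometrically, relative to the modulus of
their centres, when they are pulled back along the orbit. Hence every iterate is almost affine on a disk
whose image has a diameter comparable to the modulus of the endpoint
(\<open>set_B_iterate\<close>), and arbitrarily small neighbourhoods of \<open>z\<close> are eventually mapped
over full circles around \<open>0\<close> (\<open>set_B_iterate_circle\<close>).

Start in the ring \<open>r < \<bar>z\<bar> < 2 r\<close>, and consider the points that leave \<open>B\<close> for
the first time at step \<open>n\<close>. Around such a point there is a disk on which the \<open>n\<close>-th iterate is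
almost affine and maps into the annulus of the endpoint, where \<open>B\<close> misses at most a proportion
\<open>\<alpha>(\<beta>\<^sup>n(r))\<close>. So these points occupy a proportion of the same order of the disk,
and a Vitali covering bounds the measure of their set by a constant times \<open>\<alpha>(\<beta>\<^sup>n(r)) r\<^sup>2\<close>
(\<open>first_exit_cover\<close>). The bounds are added up over \<open>n\<close>; if \<open>r\<close> is a late member of the orbit
of \<open>r\<^sub>0\<close> under \<open>\<beta>\<close>, the sum is smaller than the area of the ring, and a set of positive
measure never leaves \<open>B\<close> (\<open>set_B_orbits_positive_measure\<close>).

Suppose that such a point \<open>z\<close> lies in a component \<open>U\<close> of the Fatou set. Then the
iterates tend to infinity locally uniformly on \<open>U\<close>, and Harnack's inequality makes
\<open>log \<bar>f\<^sup>n\<bar>\<close> comparable at any two points of \<open>U\<close>. If \<open>f\<^sup>n(U)\<close> and \<open>f\<^sup>k(U)\<close> met for some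
\<open>n < k\<close>, this would bound \<open>log \<bar>f\<^sup>j\<^sup>+\<^sup>1(z)\<bar>\<close> by a multiple of \<open>log \<bar>f\<^sup>j(z)\<bar>\<close>. As small neighbourhoods
of \<open>z\<close> are mapped over the circle through \<open>f\<^sup>j(z)\<close>, a further use of Harnack's inequality would bound
\<open>\<bar>f\<bar>\<close> on that circle by a fixed power of its radius, and \<open>f\<close> would be a polynomial. So \<open>U\<close> is
wandering (\<open>orbit_component_wandering\<close>), and so is the component containing any point of the orbit of
\<open>z\<close>. For large \<open>n\<close> the component \<open>U\<^sub>n\<close> of \<open>f\<^sup>n(z)\<close> contains the circle through
\<open>f\<^sup>n(z)\<close> around \<open>0\<close>. If all wandering domains are simply connected, then \<open>U\<^sub>n\<close> also contains
\<open>0\<close>; so \<open>U\<^sub>n = U\<^sub>n\<^sub>+\<^sub>1\<close>, which contradicts wandering (\<open>orbit_in_julia_set\<close>).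
\<close>

section \<open>Functions with positive real part\<close>

text \<open>
This is the Schwarz lemma after the Cayley transform that maps the right half plane onto the unit disk
and \<open>p z\<close> to \<open>0\<close>. Multiplied out, it avoids dividing by the distance to the boundary.
\<close>

lemma Schwarz_Re_pos:
  fixes p :: "complex \<Rightarrow> complex"
  assumes hol: "p holomorphic_on ball z R"
    and pos: "\<And>u. u \<in> ball z R \<Longrightarrow> 0 < Re (p u)"
    and a: "a \<in> ball z R"
  shows "norm (p a - p z) * (R - norm (a - z)) \<le> 2 * norm (a - z) * Re (p z)"
proof -
  have R: "0 < R" using a by (metis ball_eq_empty equals0D linorder_not_le)
  define q where "q = p z"
  have q: "0 < Re q" using pos[of z] R by (simp add: q_def)
  define h where "h = (\<lambda>w. (p (z + of_real R * w) - q) / (p (z + of_real R * w) + cnj q))"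
  have inb: "z + of_real R * w \<in> ball z R" if "norm w < 1" for w
    using that R by (simp add: dist_norm norm_mult)
  have nz: "p (z + of_real R * w) + cnj q \<noteq> 0" if "norm w < 1" for w
    using pos[OF inb[OF that]] q by (auto simp: complex_eq_iff)
  have less: "norm (P - q) < norm (P + cnj q)" if "0 < Re P" for P
  proof -
    have "(norm (P + cnj q))\<^sup>2 - (norm (P - q))\<^sup>2 = 4 * Re P * Re q"
      by (simp only: cmod_power2) (simp add: power2_eq_square algebra_simps)
    moreover have "4 * Re P * Re q > 0" using that q by simp
    ultimately have "(norm (P - q))\<^sup>2 < (norm (P + cnj q))\<^sup>2" by linarith
    then show ?thesis by (rule power_less_imp_less_base) simp
  qed
  define w where "w = (a - z) / of_real R"
  have w1: "norm w < 1" using a R by (simp add: w_def norm_divide dist_norm norm_minus_commute)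
  have wa: "z + of_real R * w = a" using R by (simp add: w_def)
  have "norm (h w) \<le> norm w"
  proof (rule Schwarz_Lemma(1))
    have "(\<lambda>w. p (z + of_real R * w)) holomorphic_on ball 0 1"
      using inb by (intro holomorphic_on_compose_gen[OF _ hol, unfolded o_def] holomorphic_intros) auto
    then show "h holomorphic_on ball 0 1"
      unfolding h_def using nz by (intro holomorphic_intros) auto
    show "h 0 = 0" by (simp add: h_def q_def)
    show "norm (h w) < 1" if "norm w < 1" for w
      using less[OF pos[OF inb[OF that]]] nz[OF that] by (simp add: h_def norm_divide)
  qed (fact w1)
  then have "norm (p a - q) \<le> norm w * norm (p a + cnj q)"
    using nz[OF w1] unfolding h_def wa norm_divide by (simp add: pos_divide_le_eq)
  also have "norm (p a + cnj q) \<le> norm (p a - q) + 2 * Re q"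
  proof -
    have "p a + cnj q = (p a - q) + of_real (2 * Re q)" by (simp add: complex_eq_iff)
    then show ?thesis using norm_triangle_ineq[of "p a - q" "of_real (2 * Re q)"] q
      by (metis abs_of_pos mult_pos_pos norm_of_real zero_less_numeral)
  qed
  finally have *: "norm (p a - q) \<le> norm w * (norm (p a - q) + 2 * Re q)"
    by (simp add: mult_left_mono)
  have "norm w = norm (a - z) / R" using R by (simp add: w_def norm_divide)
  then have "norm w * R = norm (a - z)" using R by simp
  moreover have "norm (p a - q) * R \<le> norm w * R * (norm (p a - q) + 2 * Re q)"
    using mult_right_mono[OF *, of R] R by (simp add: mult_ac)
  ultimately show ?thesis by (simp add: q_def[symmetric] algebra_simps)
qed

text \<open>
Harnack's inequality for the positive harmonic function \<open>log \<bar>g\<bar>\<close>, which is the real part of a branch of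
\<open>log g\<close>.
\<close>

lemma Harnack_log_norm:
  assumes g: "g holomorphic_on ball x R" and big: "\<And>u. u \<in> ball x R \<Longrightarrow> 1 < norm (g u)"
    and y: "norm (y - x) \<le> R / 2" and R: "0 < R"
  shows "ln (norm (g y)) \<le> 3 * ln (norm (g x))"
proof -
  have nz: "g u \<noteq> 0" if "u \<in> ball x R" for u using big[OF that] by auto
  have xb: "x \<in> ball x R" and yb: "y \<in> ball x R" using R y by (auto simp: dist_norm norm_minus_commute)
  obtain h where h: "h holomorphic_on ball x R" "\<And>u. u \<in> ball x R \<Longrightarrow> exp (h u) = g u"
    using holomorphic_logarithm_exists[OF convex_ball open_ball g nz xb] by blast
  have Re: "Re (h u) = ln (norm (g u))" if "u \<in> ball x R" for u
    using h(2)[OF that, symmetric] by simp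
  have pos: "0 < Re (h u)" if "u \<in> ball x R" for u using Re[OF that] big[OF that] by (simp add: ln_gt_zero)
  have "norm (h y - h x) * (R / 2) \<le> norm (h y - h x) * (R - norm (y - x))"
    using y by (intro mult_left_mono) auto
  also have "\<dots> \<le> 2 * norm (y - x) * Re (h x)" by (rule Schwarz_Re_pos[OF h(1) pos yb])
  also have "\<dots> \<le> 2 * (R / 2) * Re (h x)" using y pos[OF xb] by (intro mult_right_mono) auto
  finally have "norm (h y - h x) \<le> 2 * Re (h x)" using R by (simp add: field_simps)
  moreover have "Re (h y) - Re (h x) \<le> norm (h y - h x)" using complex_Re_le_cmod[of "h y - h x"] by simp
  ultimately show ?thesis using Re[OF xb] Re[OF yb] by linarith
qed

section \<open>The map near a point of \<open>B\<close>\<close>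

lemma set_B_basic:
  assumes "z \<in> set_B \<beta> f"
  shows "f z \<noteq> 0" "deriv f z \<noteq> 0" "z \<noteq> 0" "64 < norm z * norm (deriv f z / f z)"
    "\<beta> (norm z) < norm (f z)"
proof -
  have *: "f z \<noteq> 0" "Re (z * deriv f z / f z) > 64" "\<beta> (norm z) < norm (f z)"
    using assms by (auto simp: set_B_def set_A_def)
  then show "f z \<noteq> 0" "\<beta> (norm z) < norm (f z)" by auto
  show "deriv f z \<noteq> 0" "z \<noteq> 0" using *(2) by auto
  have "norm (z * (deriv f z / f z)) > 64"
    using *(2) complex_Re_le_cmod[of "z * (deriv f z / f z)"] by simp
  then show "64 < norm z * norm (deriv f z / f z)" by (simp only: norm_mult)
qed

text \<open>
The logarithm of \<open>f\<close> on the disk that the definition of \<open>B\<close> provides. Its derivative is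
\<open>p(\<zeta>) / \<zeta>\<close>, where \<open>p(\<zeta>) = \<zeta> f'(\<zeta>) / f(\<zeta>)\<close> has positive real part. The variation of \<open>p\<close> is bounded
by the Schwarz lemma, that of \<open>1 / \<zeta>\<close> by \<open>\<rho> < \<bar>z\<bar> / 2\<close>. The bound is linear in the
distance to \<open>z\<close>; this is needed to make the radius in the next lemma larger than \<open>\<pi>\<close>.
\<close>

lemma set_B_log:
  assumes f: "f holomorphic_on UNIV" and z: "z \<in> set_B \<beta> f"
    and l: "l = deriv f z / f z" and \<rho>: "\<rho> = 32 / norm l"
  obtains L where
    "\<And>\<zeta>. \<zeta> \<in> ball z \<rho> \<Longrightarrow> f \<zeta> \<noteq> 0"
    "\<And>\<zeta>. \<zeta> \<in> ball z \<rho> \<Longrightarrow> exp (L \<zeta>) = f \<zeta>"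
    "\<And>\<zeta>. \<zeta> \<in> ball z \<rho> \<Longrightarrow> (L has_field_derivative deriv f \<zeta> / f \<zeta>) (at \<zeta>)"
    "\<And>\<zeta>. norm (\<zeta> - z) \<le> \<rho> / 5 \<Longrightarrow>
       norm (deriv f \<zeta> / f \<zeta> - l) \<le> 10 / 3 * (norm (\<zeta> - z) / \<rho>) * norm l"
proof -
  note b = set_B_basic[OF z]
  have l0: "norm l > 0" using b l by simp
  then have \<rho>0: "\<rho> > 0" using \<rho> by simp
  have \<rho>z: "\<rho> < norm z / 2" using b(4) l0 unfolding \<rho> l[symmetric] by (simp add: field_simps)
  have "32 * norm (f z / deriv f z) = \<rho>" unfolding \<rho> l by (simp add: norm_divide)
  then have nz: "f \<zeta> \<noteq> 0" and Re: "Re (\<zeta> * deriv f \<zeta> / f \<zeta>) > 0" if "\<zeta> \<in> ball z \<rho>" for \<zeta>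
    using z that by (auto simp: set_B_def dist_norm norm_minus_commute)
  have fb: "f holomorphic_on ball z \<rho>" using f holomorphic_on_subset by blast
  obtain L where L: "L holomorphic_on ball z \<rho>" "\<And>x. x \<in> ball z \<rho> \<Longrightarrow> exp (L x) = f x"
    using holomorphic_logarithm_exists[OF convex_ball open_ball fb nz, of z] \<rho>0 by auto
  have dL: "(L has_field_derivative deriv f \<zeta> / f \<zeta>) (at \<zeta>)" if \<zeta>: "\<zeta> \<in> ball z \<rho>" for \<zeta>
  proof -
    have d: "(L has_field_derivative deriv L \<zeta>) (at \<zeta>)"
      using L(1) \<zeta> by (meson holomorphic_derivI open_ball)
    then have "((\<lambda>x. exp (L x)) has_field_derivative exp (L \<zeta>) * deriv L \<zeta>) (at \<zeta>)"
      by (rule DERIV_fun_exp)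
    moreover have "(f has_field_derivative deriv f \<zeta>) (at \<zeta>)"
      using fb \<zeta> by (meson holomorphic_derivI open_ball)
    then have "((\<lambda>x. exp (L x)) has_field_derivative deriv f \<zeta>) (at \<zeta>)"
      by (rule has_field_derivative_transform_within_open[OF _ open_ball \<zeta>]) (use L(2) in auto)
    ultimately have "exp (L \<zeta>) * deriv L \<zeta> = deriv f \<zeta>" by (rule DERIV_unique)
    then have "deriv L \<zeta> = deriv f \<zeta> / f \<zeta>" using L(2)[OF \<zeta>] nz[OF \<zeta>] by (simp add: field_simps)
    then show ?thesis using d by simp
  qed
  have est: "norm (deriv f \<zeta> / f \<zeta> - l) \<le> 10 / 3 * (norm (\<zeta> - z) / \<rho>) * norm l"
    if d: "norm (\<zeta> - z) \<le> \<rho> / 5" for \<zeta>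
  proof -
    define p where "p = (\<lambda>\<zeta>. \<zeta> * deriv f \<zeta> / f \<zeta>)"
    define d where "d = norm (\<zeta> - z)"
    have d5: "d \<le> \<rho> / 5" using that d_def by simp
    have \<zeta>b: "\<zeta> \<in> ball z \<rho>" using that \<rho>0 by (simp add: dist_norm norm_minus_commute)
    have "p holomorphic_on ball z \<rho>" unfolding p_def
      using nz fb by (intro holomorphic_intros) auto
    from Schwarz_Re_pos[OF this _ \<zeta>b] Re
    have "norm (p \<zeta> - p z) * (\<rho> - d) \<le> 2 * d * Re (p z)" unfolding p_def d_def by auto
    also have "\<dots> \<le> 2 * d * norm (p z)" by (intro mult_left_mono complex_Re_le_cmod) (simp add: d_def)
    also have "norm (p z) = norm z * norm l" by (simp add: p_def l norm_mult norm_divide)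
    finally have 1: "norm (p \<zeta> - p z) * (\<rho> - d) \<le> 2 * d * (norm z * norm l)" .
    have "norm (p \<zeta> - p z) * (4/5 * \<rho>) \<le> norm (p \<zeta> - p z) * (\<rho> - d)"
      using d5 by (intro mult_left_mono) auto
    with 1 have 2: "norm (p \<zeta> - p z) \<le> 5/2 * d / \<rho> * (norm z * norm l)"
      using \<rho>0 by (simp add: field_simps)
    have "norm z \<le> norm \<zeta> + d" unfolding d_def by (metis add.commute norm_minus_commute norm_triangle_sub)
    then have \<zeta>n: "norm \<zeta> \<ge> 9/10 * norm z" using d5 \<rho>z by linarith
    have z0: "norm z > 0" using b by simp
    then have \<zeta>0: "norm \<zeta> > 0" using \<zeta>n by linarith
    have eq: "deriv f \<zeta> / f \<zeta> - l = ((p \<zeta> - p z) + l * (z - \<zeta>)) / \<zeta>"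
      using \<zeta>0 nz[OF \<zeta>b] b(1) by (simp add: p_def l field_simps)
    have "norm ((p \<zeta> - p z) + l * (z - \<zeta>)) \<le> 5/2 * d / \<rho> * (norm z * norm l) + norm l * d"
      using norm_triangle_ineq[of "p \<zeta> - p z" "l * (z - \<zeta>)"] 2
      by (simp add: norm_mult d_def norm_minus_commute)
    also have "norm l * d \<le> 1/2 * d / \<rho> * (norm z * norm l)"
      using \<rho>z \<rho>0 l0 mult_left_mono[of "2 * \<rho>" "norm z" "norm l * d"]
      by (simp add: field_simps d_def)
    finally have "norm ((p \<zeta> - p z) + l * (z - \<zeta>)) \<le> 3 * (d / \<rho>) * norm l * norm z"
      by (simp add: field_simps)
    also have "\<dots> \<le> 3 * (d / \<rho>) * norm l * (10/9 * norm \<zeta>)"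
      using \<zeta>n \<rho>0 by (intro mult_left_mono) (auto simp: d_def)
    finally have "norm ((p \<zeta> - p z) + l * (z - \<zeta>)) / norm \<zeta> \<le> 10/3 * (d / \<rho>) * norm l"
      using \<zeta>0 by (simp add: pos_divide_le_eq mult_ac)
    then show ?thesis unfolding eq norm_divide d_def .
  qed
  show ?thesis using that[OF nz L(2) dL est] by blast
qed


text \<open>
The image of the disk of radius \<open>\<rho> / 5\<close> under the branch \<open>L\<close> of \<open>log f\<close> contains the disk of radius
\<open>4\<close> around \<open>L z\<close>: integrating the linear bound on \<open>L' - l\<close> shows that \<open>L\<close> moves
the boundary circle at least \<open>(2/3) \<bar>l\<bar> \<rho> / 5 = 64 / 15 > 4\<close> away from \<open>L z\<close>, and \<open>L\<close> is an open map. The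
same lower bound on \<open>\<bar>L a - L z\<bar>\<close>, together with \<open>\<bar>z l\<bar> > 64\<close>, locates the preimage.
\<close>

lemma set_B_cover:
  assumes f: "f holomorphic_on UNIV" and z: "z \<in> set_B \<beta> f" and v: "norm v < 4"
  shows "\<exists>a. f a = f z * exp v \<and> norm (a - z) \<le> 3 / 2 * norm v * (norm z / 64)"
proof -
  note b = set_B_basic[OF z]
  define l where "l = deriv f z / f z"
  define \<rho> where "\<rho> = 32 / norm l"
  obtain L where
    nz: "\<And>\<zeta>. \<zeta> \<in> ball z \<rho> \<Longrightarrow> f \<zeta> \<noteq> 0" and
    eL: "\<And>\<zeta>. \<zeta> \<in> ball z \<rho> \<Longrightarrow> exp (L \<zeta>) = f \<zeta>" and
    dL: "\<And>\<zeta>. \<zeta> \<in> ball z \<rho> \<Longrightarrow> (L has_field_derivative deriv f \<zeta> / f \<zeta>) (at \<zeta>)" and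
    est: "\<And>\<zeta>. norm (\<zeta> - z) \<le> \<rho> / 5 \<Longrightarrow>
       norm (deriv f \<zeta> / f \<zeta> - l) \<le> 10 / 3 * (norm (\<zeta> - z) / \<rho>) * norm l"
    using set_B_log[OF f z l_def \<rho>_def] by metis
  have l0: "norm l > 0" using b by (simp add: l_def)
  then have \<rho>0: "\<rho> > 0" by (simp add: \<rho>_def)
  have lz: "1 / norm l \<le> norm z / 64" using b(4) l0 unfolding l_def[symmetric] by (simp add: field_simps)
  have quad: "norm (L a - L z - l * (a - z)) \<le> 5 / 3 * (norm (a - z))\<^sup>2 / \<rho> * norm l"
    if a: "norm (a - z) \<le> \<rho> / 5" for a
  proof -
    define d where "d = norm (a - z)"
    define \<gamma> where "\<gamma> = (\<lambda>t::real. z + of_real t * (a - z))"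
    define \<phi> where "\<phi> = (\<lambda>t::real. L (\<gamma> t) - l * \<gamma> t)"
    have \<gamma>n: "norm (\<gamma> t - z) = t * d" if "0 \<le> t" for t
      using that by (simp add: \<gamma>_def d_def norm_mult)
    have \<gamma>5: "norm (\<gamma> t - z) \<le> \<rho> / 5" if "0 \<le> t" "t \<le> 1" for t
      using mult_left_le_one_le[of d t] that a by (simp add: \<gamma>n d_def)
    have \<gamma>b: "\<gamma> t \<in> ball z \<rho>" if "0 \<le> t" "t \<le> 1" for t
      using \<gamma>5[OF that] \<rho>0 by (simp add: dist_norm norm_minus_commute)
    have d\<phi>: "(\<phi> has_vector_derivative ((deriv f (\<gamma> t) / f (\<gamma> t) - l) * (a - z))) (at t)"
      if "0 \<le> t" "t \<le> 1" for t
    proof -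
      have 1: "(\<gamma> has_vector_derivative (a - z)) (at t)"
        unfolding \<gamma>_def by (auto intro!: derivative_eq_intros)
      have "((\<lambda>u. L u - l * u) has_field_derivative (deriv f (\<gamma> t) / f (\<gamma> t) - l)) (at (\<gamma> t))"
        using dL[OF \<gamma>b[OF that]] by (auto intro!: derivative_eq_intros)
      from field_vector_diff_chain_at[OF 1 this] show ?thesis
        by (simp add: \<phi>_def o_def mult.commute)
    qed
    have "norm (\<phi> 1 - \<phi> 0) \<le> 5/3 * d^2 / \<rho> * norm l * 1^2 - 5/3 * d^2 / \<rho> * norm l * 0^2"
    proof (rule differentiable_bound_general[where \<phi> = "\<lambda>t. 5/3 * d^2 / \<rho> * norm l * t^2"
          and \<phi>' = "\<lambda>t. 10/3 * d^2 / \<rho> * norm l * t"])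
      show "continuous_on {0..1} \<phi>"
        using d\<phi> by (intro continuous_at_imp_continuous_on ballI)
          (auto intro!: has_vector_derivative_continuous)
      show "continuous_on {0..1} (\<lambda>t. 5/3 * d^2 / \<rho> * norm l * t^2)"
        by (intro continuous_intros)
      fix t :: real assume t: "0 < t" "t < 1"
      show "(\<phi> has_vector_derivative ((deriv f (\<gamma> t) / f (\<gamma> t) - l) * (a - z))) (at t)"
        using d\<phi> t by simp
      show "((\<lambda>t. 5/3 * d^2 / \<rho> * norm l * t^2) has_vector_derivative 10/3 * d^2 / \<rho> * norm l * t) (at t)"
        unfolding has_real_derivative_iff_has_vector_derivative[symmetric]
        using \<rho>0 by (auto intro!: derivative_eq_intros)
      have "norm (deriv f (\<gamma> t) / f (\<gamma> t) - l) \<le> 10 / 3 * (t * d / \<rho>) * norm l"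
        using est[of "\<gamma> t"] \<gamma>5[of t] \<gamma>n[of t] t by simp
      then have "norm (deriv f (\<gamma> t) / f (\<gamma> t) - l) * d \<le> 10 / 3 * (t * d / \<rho>) * norm l * d"
        by (rule mult_right_mono) (simp add: d_def)
      then show "norm ((deriv f (\<gamma> t) / f (\<gamma> t) - l) * (a - z)) \<le> 10/3 * d^2 / \<rho> * norm l * t"
        by (simp add: norm_mult d_def power2_eq_square mult_ac)
    qed simp
    then show ?thesis by (simp add: \<phi>_def \<gamma>_def d_def algebra_simps)
  qed
  have lower: "2 / 3 * norm l * norm (a - z) \<le> norm (L a - L z)" if a: "norm (a - z) \<le> \<rho> / 5" for a
  proof -
    have "5 / 3 * (norm (a - z))\<^sup>2 / \<rho> * norm l \<le> 1 / 3 * norm l * norm (a - z)"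
      using mult_right_mono[OF a, of "norm l * norm (a - z)"] \<rho>0
      by (simp add: field_simps power2_eq_square)
    moreover have "norm (l * (a - z)) \<le> norm (L a - L z) + norm (L a - L z - l * (a - z))"
      by (metis norm_minus_commute norm_triangle_sub)
    moreover have "norm (l * (a - z)) = norm l * norm (a - z)" by (rule norm_mult)
    ultimately show ?thesis using quad[OF a] by linarith
  qed
  have "ball (L z) 4 \<subseteq> L ` ball z (\<rho> / 5)"
  proof (rule ball_subset_open_map_image)
    have sub: "cball z (\<rho> / 5) \<subseteq> ball z \<rho>" using \<rho>0 by auto
    have "continuous_on (cball z (\<rho> / 5)) L"
      by (intro continuous_at_imp_continuous_on ballI DERIV_isCont[OF dL]) (use sub in auto)
    then show "continuous_on (closure (ball z (\<rho> / 5))) L" using \<rho>0 by simp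
    have hol: "L holomorphic_on ball z (\<rho> / 5)"
    proof (rule holomorphic_onI)
      fix u assume "u \<in> ball z (\<rho> / 5)"
      then have "u \<in> ball z \<rho>" using \<rho>0 by auto
      from dL[OF this] show "L field_differentiable at u within ball z (\<rho> / 5)"
        by (metis field_differentiable_at_within field_differentiable_def)
    qed
    have "\<not> L constant_on ball z (\<rho> / 5)"
    proof (rule nonzero_deriv_nonconstant)
      show "(L has_field_derivative l) (at z)" using dL[of z] \<rho>0 by (simp add: l_def)
    qed (use l0 \<rho>0 in auto)
    then show "open (L ` interior (ball z (\<rho> / 5)))"
      using open_mapping_thm[OF hol open_ball connected_ball open_ball] by simp
    show "4 \<le> norm (L u - L z)" if "u \<in> frontier (ball z (\<rho> / 5))" for u
    proof -
      have "norm (u - z) = \<rho> / 5"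
        using that \<rho>0 by (simp add: frontier_ball dist_norm norm_minus_commute)
      moreover from this have "norm l * norm (u - z) = 32 / 5" using l0 by (simp add: \<rho>_def)
      ultimately show ?thesis using lower[of u] by linarith
    qed
  qed (use \<rho>0 in auto)
  moreover have "L z + v \<in> ball (L z) 4" using v by (simp add: dist_norm)
  ultimately obtain a where a: "a \<in> ball z (\<rho> / 5)" "L a = L z + v" by (metis imageE subsetD)
  have ab: "a \<in> ball z \<rho>" "norm (a - z) \<le> \<rho> / 5" using a(1) \<rho>0 by (auto simp: dist_norm norm_minus_commute)
  have "f a = f z * exp v"
    using eL[OF ab(1)] eL[of z] \<rho>0 a(2) by (simp add: exp_add)
  moreover have "norm (a - z) \<le> 3 / 2 * norm v * (1 / norm l)"
    using lower[OF ab(2)] a(2) l0 by (simp add: field_simps)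
  then have "norm (a - z) \<le> 3 / 2 * norm v * (norm z / 64)"
    using mult_left_mono[OF lz, of "3 / 2 * norm v"] by simp
  ultimately show ?thesis by blast
qed

text \<open>
Inverse branches contract distances that are measured relative to the modulus. The factor comes from
\<open>\<bar>z f' z / f z\<bar> > 64\<close> on \<open>B\<close>, with some loss from the logarithm.
\<close>

lemma set_B_pullback:
  assumes f: "f holomorphic_on UNIV" and z: "z \<in> set_B \<beta> f" 
    and w: "norm (w - f z) < t * norm (f z)" and t: "t \<le> 1 / 2"
  shows "\<exists>a. f a = w \<and> norm (a - z) < t / 10 * norm z"
proof -
  note b = set_B_basic[OF z]
  define x where "x = (w - f z) / f z"
  have x: "norm x < t" using w b(1) by (simp add: x_def norm_divide pos_divide_less_eq)
  have Ln: "norm (Ln (1 + x)) \<le> 2 * norm x" using x t by (intro norm_Ln_le) auto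
  obtain a where a: "f a = f z * exp (Ln (1 + x))" 
    "norm (a - z) \<le> 3 / 2 * norm (Ln (1 + x)) * (norm z / 64)"
    using set_B_cover[OF f z, of "Ln (1 + x)"] Ln x t by auto
  have "1 + x = w / f z" using b(1) by (simp add: x_def field_simps)
  moreover have "1 + x \<noteq> 0" 
  proof
    assume "1 + x = 0"
    then have "x = -1" by (simp add: add_eq_0_iff)
    then show False using x t by simp
  qed
  ultimately have "f a = w" using a(1) b(1) by simp
  moreover have "norm (a - z) < t / 10 * norm z"
  proof -
    have "3 / 2 * norm (Ln (1 + x)) * (norm z / 64) \<le> 3 / 2 * (2 * norm x) * (norm z / 64)"
      using Ln by (intro mult_right_mono mult_left_mono) auto
    also have "\<dots> \<le> norm x / 10 * norm z" by simp
    also have "\<dots> < t / 10 * norm z" using x b(3) by (intro mult_strict_right_mono) auto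
    finally show ?thesis using a(2) by linarith
  qed
  ultimately show ?thesis by blast
qed

text \<open>
A point on the circle through \<open>f z\<close> is \<open>f z * exp (\<i> t)\<close> with \<open>\<bar>t\<bar> \<le> \<pi> < 4\<close>.
\<close>

lemma set_B_circle:
  assumes f: "f holomorphic_on UNIV" and z: "z \<in> set_B \<beta> f" and w: "norm w = norm (f z)"
  shows "\<exists>a. f a = w \<and> norm (a - z) < norm z / 2"
proof -
  note b = set_B_basic[OF z]
  have q: "norm (w / f z) = 1" using w b(1) by (simp add: norm_divide)
  then have q0: "w / f z \<noteq> 0" by auto
  have "Re (Ln (w / f z)) = 0" using q q0 by (simp add: Re_Ln)
  then have "norm (Ln (w / f z)) \<le> \<bar>Im (Ln (w / f z))\<bar>" using cmod_le[of "Ln (w / f z)"] by simp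
  also have "\<dots> \<le> pi" using mpi_less_Im_Ln[OF q0] Im_Ln_le_pi[OF q0] by simp
  also have "pi < 4" by (rule pi_less_4)
  finally have v: "norm (Ln (w / f z)) < 4" .
  obtain a where a: "f a = f z * exp (Ln (w / f z))" 
    "norm (a - z) \<le> 3 / 2 * norm (Ln (w / f z)) * (norm z / 64)"
    using set_B_cover[OF f z v] by blast
  have "3 / 2 * norm (Ln (w / f z)) * (norm z / 64) \<le> 3 / 2 * 4 * (norm z / 64)"
    using v by (intro mult_right_mono mult_left_mono) auto
  also have "\<dots> < norm z / 2" using b(3) by simp
  finally have "norm (a - z) < norm z / 2" using a(2) by linarith
  moreover have "f a = w" using a(1) b(1) q0 by simp
  ultimately show ?thesis by blast
qed

text \<open>
Affine approximation on a small disk: the relative variation of \<open>f'\<close> there is at most \<open>3 \<sigma>\<close>, because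
\<open>f' = exp L * L'\<close> and both factors are controlled by the bound on \<open>L'\<close>.
\<close>

lemma set_B_step:
  assumes f: "f holomorphic_on UNIV" and z: "z \<in> set_B \<beta> f"
    and \<sigma>: "\<sigma> \<le> 1 / 24"
    and a: "norm (a - z) * norm (deriv f z) \<le> \<sigma> * norm (f z)"
    and b: "norm (b - z) * norm (deriv f z) \<le> \<sigma> * norm (f z)"
  shows "norm (f a - f b - deriv f z * (a - b)) \<le> 3 * \<sigma> * norm (deriv f z) * norm (a - b)"
proof -
  note bas = set_B_basic[OF z]
  define l where "l = deriv f z / f z"
  define \<rho> where "\<rho> = 32 / norm l"
  obtain L where
    nz: "\<And>\<zeta>. \<zeta> \<in> ball z \<rho> \<Longrightarrow> f \<zeta> \<noteq> 0" and
    eL: "\<And>\<zeta>. \<zeta> \<in> ball z \<rho> \<Longrightarrow> exp (L \<zeta>) = f \<zeta>" and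
    dL: "\<And>\<zeta>. \<zeta> \<in> ball z \<rho> \<Longrightarrow> (L has_field_derivative deriv f \<zeta> / f \<zeta>) (at \<zeta>)" and
    est: "\<And>\<zeta>. norm (\<zeta> - z) \<le> \<rho> / 5 \<Longrightarrow>
       norm (deriv f \<zeta> / f \<zeta> - l) \<le> 10 / 3 * (norm (\<zeta> - z) / \<rho>) * norm l"
    using set_B_log[OF f z l_def \<rho>_def] by metis
  have l0: "norm l > 0" using bas by (simp add: l_def)
  then have \<rho>0: "\<rho> > 0" by (simp add: \<rho>_def)
  have "0 \<le> \<sigma> * norm (f z)" using a by (meson mult_nonneg_nonneg norm_ge_zero order_trans)
  then have \<sigma>0: "0 \<le> \<sigma>" using bas(1) by (simp add: zero_le_mult_iff)
  define D where "D = cball z (\<sigma> / norm l)"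
  have \<sigma>\<rho>: "\<sigma> / norm l = \<sigma> / 32 * \<rho>" using l0 by (simp add: \<rho>_def)
  have D5: "norm (u - z) \<le> \<sigma> / 32 * \<rho>" if "u \<in> D" for u
    using that by (simp add: D_def \<sigma>\<rho> dist_norm norm_minus_commute)
  have \<sigma>5: "\<sigma> / 32 * \<rho> \<le> \<rho> / 5" "\<sigma> / 32 * \<rho> < \<rho>" using \<sigma> \<rho>0 by simp_all
  have Db: "u \<in> ball z \<rho>" if "u \<in> D" for u
    using D5[OF that] \<sigma>5 by (simp add: dist_norm norm_minus_commute)
  have e1: "norm (deriv f u / f u - l) \<le> \<sigma> / 9 * norm l" if "u \<in> D" for u
  proof -
    have "norm (deriv f u / f u - l) \<le> 10 / 3 * (norm (u - z) / \<rho>) * norm l"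
      using est[of u] D5[OF that] \<sigma>5 by simp
    also have "\<dots> \<le> 10 / 3 * (\<sigma> / 32) * norm l"
      using D5[OF that] \<rho>0 by (intro mult_right_mono mult_left_mono) (auto simp: field_simps)
    also have "\<dots> \<le> \<sigma> / 9 * norm l" using \<sigma>0 by (intro mult_right_mono) auto
    finally show ?thesis .
  qed
  have zD: "z \<in> D" using \<sigma>0 l0 by (simp add: D_def)
  have e2: "norm (L u - L z) \<le> 16 / 15 * \<sigma>" if u: "u \<in> D" for u
  proof -
    have "norm (L u - L z) \<le> (16 / 15 * norm l) * norm (u - z)"
    proof (rule field_differentiable_bound[where S = D])
      show "(L has_field_derivative deriv f u / f u) (at u within D)" if "u \<in> D" for u
        using dL[OF Db[OF that]] by (rule has_field_derivative_at_within)
      show "norm (deriv f u / f u) \<le> 16 / 15 * norm l" if "u \<in> D" for u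
      proof -
        have "norm (deriv f u / f u) \<le> norm l + norm (deriv f u / f u - l)" by (rule norm_triangle_sub)
        also have "\<dots> \<le> norm l + \<sigma> / 9 * norm l" using e1[OF that] by simp
        also have "\<dots> = (1 + \<sigma> / 9) * norm l" by (simp add: algebra_simps)
        also have "\<dots> \<le> 16 / 15 * norm l" using \<sigma> by (intro mult_right_mono) auto
        finally show ?thesis .
      qed
    qed (use u zD in \<open>auto simp: D_def\<close>)
    also have "\<dots> \<le> (16 / 15 * norm l) * (\<sigma> / norm l)"
      using u by (intro mult_left_mono) (auto simp: D_def dist_norm norm_minus_commute)
    also have "\<dots> = 16 / 15 * \<sigma>" using l0 by simp
    finally show ?thesis .
  qed
  have e3: "norm (deriv f u - deriv f z) \<le> 3 * \<sigma> * norm (deriv f z)" if u: "u \<in> D" for u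
  proof -
    define e where "e = exp (L u - L z)"
    have fu: "f u = f z * e" using eL[OF Db[OF u]] eL[OF Db[OF zD]] bas(1) by (simp add: e_def exp_diff)
    have half: "norm (L u - L z) \<le> 1 / 2" using e2[OF u] \<sigma> by simp
    have e: "norm e \<le> 2" unfolding e_def by (rule exp_bound_half[OF half])
    have e': "norm (e - 1) \<le> 8 / 5 * \<sigma>"
      using norm_exp_bounds(2)[OF half] e2[OF u] unfolding e_def by linarith
    have "deriv f u - deriv f z = f z * (e * (deriv f u / f u - l) + l * (e - 1))"
      using nz[OF Db[OF u]] bas(1) unfolding fu l_def by (simp add: field_simps)
    also have "norm \<dots> \<le> norm (f z) * (norm e * norm (deriv f u / f u - l) + norm l * norm (e - 1))"
      by (metis mult_left_mono norm_ge_zero norm_mult norm_triangle_ineq)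
    also have "\<dots> \<le> norm (f z) * (2 * (\<sigma> / 9 * norm l) + norm l * (8 / 5 * \<sigma>))"
      by (intro mult_left_mono add_mono mult_mono e e1[OF u] e') auto
    also have "\<dots> \<le> norm (f z) * (3 * \<sigma> * norm l)"
      using \<sigma>0 by (intro mult_left_mono) (auto simp: algebra_simps)
    also have "\<dots> = 3 * \<sigma> * norm (deriv f z)" using bas(1) by (simp add: l_def norm_divide)
    finally show ?thesis .
  qed
  have mem: "x \<in> D" if "norm (x - z) * norm (deriv f z) \<le> \<sigma> * norm (f z)" for x
    using that bas by (simp add: D_def l_def dist_norm norm_minus_commute norm_divide field_simps)
  have "norm ((f a - deriv f z * a) - (f b - deriv f z * b)) \<le> 3 * \<sigma> * norm (deriv f z) * norm (a - b)"
  proof (rule field_differentiable_bound[where S = D])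
    show "((\<lambda>u. f u - deriv f z * u) has_field_derivative deriv f u - deriv f z) (at u within D)" if "u \<in> D" for u
    proof -
      have "(f has_field_derivative deriv f u) (at u)" using f by (simp add: holomorphic_derivI)
      then show ?thesis by (intro DERIV_diff DERIV_cmult_Id) (rule has_field_derivative_at_within)
    qed
  qed (use e3 mem a b in \<open>auto simp: D_def\<close>)
  then show ?thesis by (simp add: algebra_simps)
qed

section \<open>Iterates along an orbit in \<open>B\<close>\<close>

lemma funpow_holomorphic:
  assumes "f holomorphic_on UNIV"
  shows "(f ^^ n) holomorphic_on UNIV"
proof (induction n)
  case (Suc n)
  then show ?case
    using assms holomorphic_on_compose_gen[of "f ^^ n" UNIV f UNIV] by (simp add: o_def)
qed (simp add: id_def)

lemma funpow_orbit_Suc: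
  assumes "\<forall>k<Suc n. (f ^^ k) z \<in> B"
  shows "z \<in> B" "\<forall>k<n. (f ^^ k) (f z) \<in> B"
proof -
  show "z \<in> B" using assms by force
  show "\<forall>k<n. (f ^^ k) (f z) \<in> B"
    using assms by (metis Suc_less_eq funpow_simps_right(2) comp_apply)
qed

text \<open>
Distortion of iterates, by induction on \<open>n\<close> with the new map prepended. The quantity
\<open>\<bar>W\<bar> / (\<bar>z\<bar> \<bar>D\<bar>)\<close> is at most \<open>64\<^sup>-\<^sup>n\<close>, so on a disk of radius comparable to \<open>\<bar>W\<bar> / \<bar>D\<bar>\<close> the first map
deviates from an affine one by \<open>O(64\<^sup>-\<^sup>n)\<close> only. The errors accumulate to at most \<open>1/2\<close>: the sequence
\<open>\<epsilon> n\<close> increases to \<open>1/2\<close> by steps that exceed the deviations, and the admissible radius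
\<open>\<bar>W\<bar> / (24 \<bar>D\<bar> (1 + \<epsilon> n))\<close> shrinks accordingly, so that the first map sends each disk into the next.
\<close>

lemma set_B_iterate:
  fixes n :: nat
  defines "\<epsilon> \<equiv> \<lambda>n::nat. (1 - (1 / 2) ^ n) / (2::real)"
  assumes f: "f holomorphic_on UNIV" and z: "\<forall>k<n. (f ^^ k) z \<in> set_B \<beta> f"
    and D: "D = deriv (f ^^ n) z" and W: "W = (f ^^ n) z"
  shows "D \<noteq> 0" "norm W * 64 ^ n \<le> norm z * norm D"
    "\<And>a b. \<lbrakk>norm (a - z) * norm D * (1 + \<epsilon> n) \<le> norm W / 24; 
             norm (b - z) * norm D * (1 + \<epsilon> n) \<le> norm W / 24\<rbrakk> \<Longrightarrow>
       norm ((f ^^ n) a - (f ^^ n) b - D * (a - b)) \<le> \<epsilon> n * norm D * norm (a - b)"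
proof -
  have "D \<noteq> 0 \<and> norm W * 64 ^ n \<le> norm z * norm D \<and>
    (\<forall>a b. norm (a - z) * norm D * (1 + \<epsilon> n) \<le> norm W / 24 \<longrightarrow> 
           norm (b - z) * norm D * (1 + \<epsilon> n) \<le> norm W / 24 \<longrightarrow>
       norm ((f ^^ n) a - (f ^^ n) b - D * (a - b)) \<le> \<epsilon> n * norm D * norm (a - b))"
    using z unfolding D W
  proof (induction n arbitrary: z)
    case 0
    then show ?case by (simp add: \<epsilon>_def)
  next
    case (Suc n)
    note orb = funpow_orbit_Suc[OF Suc.prems]
    note bas = set_B_basic[OF orb(1)]
    define z1 where "z1 = f z"
    define D1 where "D1 = deriv (f ^^ n) z1"
    define d where "d = deriv f z"
    define W where "W = (f ^^ n) z1"
    note IH = Suc.IH[OF orb(2), folded z1_def, folded D1_def W_def]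
    have eq: "(f ^^ Suc n) = (f ^^ n) \<circ> f" by (rule funpow_Suc_right)
    have D: "deriv (f ^^ Suc n) z = D1 * d"
      unfolding eq D1_def d_def z1_def
      using f funpow_holomorphic[OF f, of n] 
      by (intro deriv_chain) (auto simp: holomorphic_on_def)
    have W: "(f ^^ Suc n) z = W" by (simp only: eq W_def z1_def o_apply)
    have D10: "D1 \<noteq> 0" and g1: "norm W * 64 ^ n \<le> norm z1 * norm D1"
      and est1: "\<And>a b. norm (a - z1) * norm D1 * (1 + \<epsilon> n) \<le> norm W / 24 \<Longrightarrow>
           norm (b - z1) * norm D1 * (1 + \<epsilon> n) \<le> norm W / 24 \<Longrightarrow>
       norm ((f ^^ n) a - (f ^^ n) b - D1 * (a - b)) \<le> \<epsilon> n * norm D1 * norm (a - b)"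
      using IH by blast+
    have z10: "norm z1 > 0" using bas(1) by (simp add: z1_def)
    have d0: "norm d > 0" using bas(2) by (simp add: d_def)
    have g2: "64 * norm z1 < norm z * norm d"
      using bas(4) z10 by (simp add: norm_divide d_def[symmetric] z1_def[symmetric] field_simps)
    have g: "norm W * 64 ^ Suc n \<le> norm z * norm (D1 * d)"
    proof -
      have "norm W * 64 ^ Suc n \<le> norm z1 * norm D1 * 64"
        using g1 by simp
      also have "\<dots> \<le> norm z * norm (D1 * d)"
        using mult_right_mono[OF less_imp_le[OF g2], of "norm D1"] by (simp add: norm_mult mult_ac)
      finally show ?thesis .
    qed
    define x where "x = (1 / 2 :: real) ^ n"
    define y where "y = (1 / 64 :: real) ^ n"
    define \<eta> where "\<eta> = y / 8"
    have y: "0 < y" "y \<le> x" unfolding x_def y_def by (auto intro: power_mono)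
    have x1: "x \<le> 1" unfolding x_def by (simp add: power_le_one)
    have \<epsilon>0: "0 \<le> \<epsilon> n" using x1 by (simp add: \<epsilon>_def x_def)
    \<comment> \<open>the distortion budget: the new factor eats at most half of what is left\<close>
    have budget: "(1 + \<epsilon> n) * (1 + \<eta>) \<le> 1 + \<epsilon> (Suc n)"
    proof -
      have "(1 + \<epsilon> n) * (1 + \<eta>) = 1 + \<epsilon> n + (1 + \<epsilon> n) * \<eta>" by (simp add: algebra_simps)
      also have "(1 + \<epsilon> n) * \<eta> \<le> 2 * (x / 8)"
        using y x1 by (intro mult_mono) (auto simp: \<epsilon>_def x_def[symmetric] \<eta>_def)
      finally have "(1 + \<epsilon> n) * (1 + \<eta>) \<le> 1 + \<epsilon> n + x / 4" by simp
      moreover have "\<epsilon> (Suc n) = \<epsilon> n + x / 4" by (simp add: \<epsilon>_def x_def field_simps)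
      ultimately show ?thesis by simp
    qed
    have \<eta>0: "\<eta> > 0" using y by (simp add: \<eta>_def)
    have near: "norm (a - z) * norm d \<le> y / 24 * norm z1"
      if a: "norm (a - z) * norm (D1 * d) * (1 + \<epsilon> (Suc n)) \<le> norm W / 24" for a
    proof -
      have "1 \<le> 1 + \<epsilon> (Suc n)" using x1 by (simp add: \<epsilon>_def x_def)
      then have "norm (a - z) * norm (D1 * d) \<le> norm (a - z) * norm (D1 * d) * (1 + \<epsilon> (Suc n))"
        using mult_left_mono[of 1 "1 + \<epsilon> (Suc n)" "norm (a - z) * norm (D1 * d)"] by simp
      with a have "norm (a - z) * norm (D1 * d) \<le> norm W / 24" by linarith
      then have "norm (a - z) * norm d * norm D1 \<le> norm W / 24" by (simp add: norm_mult mult_ac)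
      also have "norm W = norm W * 64 ^ n * y" by (simp add: y_def power_one_over)
      also have "\<dots> \<le> norm z1 * norm D1 * y" using g1 y by (intro mult_right_mono) auto
      finally have "norm (a - z) * norm d * norm D1 \<le> (y / 24 * norm z1) * norm D1" by (simp add: mult_ac)
      then show ?thesis using D10 by (simp add: mult_le_cancel_right)
    qed
    have step: "norm (f a - f b - d * (a - b)) \<le> \<eta> * norm d * norm (a - b)"
      if a: "norm (a - z) * norm (D1 * d) * (1 + \<epsilon> (Suc n)) \<le> norm W / 24" 
      and b: "norm (b - z) * norm (D1 * d) * (1 + \<epsilon> (Suc n)) \<le> norm W / 24" for a b
    proof -
      have "y \<le> 1" using y x1 by simp
      then show ?thesis
        using set_B_step[OF f orb(1), of "y / 24" a b] near[OF a] near[OF b]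
        by (simp add: d_def[symmetric] z1_def[symmetric] \<eta>_def)
    qed
    have lip: "norm (f a - f b) \<le> (1 + \<eta>) * norm d * norm (a - b)"
      if a: "norm (a - z) * norm (D1 * d) * (1 + \<epsilon> (Suc n)) \<le> norm W / 24" 
      and b: "norm (b - z) * norm (D1 * d) * (1 + \<epsilon> (Suc n)) \<le> norm W / 24" for a b
    proof -
      have "norm (f a - f b) \<le> norm (d * (a - b)) + norm (f a - f b - d * (a - b))"
        by (rule norm_triangle_sub)
      also have "\<dots> \<le> norm d * norm (a - b) + \<eta> * norm d * norm (a - b)"
        using step[OF a b] norm_mult[of d "a - b"] by linarith
      also have "\<dots> = (1 + \<eta>) * norm d * norm (a - b)" by (simp add: algebra_simps)
      finally show ?thesis .
    qed
    have zz: "norm (z - z) * norm (D1 * d) * (1 + \<epsilon> (Suc n)) \<le> norm W / 24" by simp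
    have dom: "norm (f a - z1) * norm D1 * (1 + \<epsilon> n) \<le> norm W / 24"
      if a: "norm (a - z) * norm (D1 * d) * (1 + \<epsilon> (Suc n)) \<le> norm W / 24" for a
    proof -
      have "norm (f a - z1) * norm D1 * (1 + \<epsilon> n) \<le> ((1 + \<eta>) * norm d * norm (a - z)) * norm D1 * (1 + \<epsilon> n)"
        using lip[OF a zz] \<epsilon>0 by (intro mult_right_mono) (auto simp: z1_def)
      also have "\<dots> = norm (a - z) * norm (D1 * d) * ((1 + \<epsilon> n) * (1 + \<eta>))"
        by (simp add: norm_mult mult_ac)
      also have "\<dots> \<le> norm (a - z) * norm (D1 * d) * (1 + \<epsilon> (Suc n))"
        using budget by (intro mult_left_mono) auto
      finally show ?thesis using a by linarith
    qed
    have "norm ((f ^^ Suc n) a - (f ^^ Suc n) b - D1 * d * (a - b))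
        \<le> \<epsilon> (Suc n) * norm (D1 * d) * norm (a - b)"
      if a: "norm (a - z) * norm (D1 * d) * (1 + \<epsilon> (Suc n)) \<le> norm W / 24" 
      and b: "norm (b - z) * norm (D1 * d) * (1 + \<epsilon> (Suc n)) \<le> norm W / 24" for a b
    proof -
      define N where "N = norm D1 * norm d * norm (a - b)"
      have N0: "N \<ge> 0" by (simp add: N_def)
      have "(f ^^ Suc n) a - (f ^^ Suc n) b - D1 * d * (a - b)
          = ((f ^^ n) (f a) - (f ^^ n) (f b) - D1 * (f a - f b)) + D1 * (f a - f b - d * (a - b))"
        by (simp only: eq o_apply) (simp add: algebra_simps)
      then have "norm ((f ^^ Suc n) a - (f ^^ Suc n) b - D1 * d * (a - b))
          \<le> norm ((f ^^ n) (f a) - (f ^^ n) (f b) - D1 * (f a - f b)) + norm D1 * norm (f a - f b - d * (a - b))"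
        by (metis norm_mult norm_triangle_ineq)
      also have "\<dots> \<le> \<epsilon> n * norm D1 * norm (f a - f b) + norm D1 * (\<eta> * norm d * norm (a - b))"
        by (intro add_mono est1 dom a b mult_left_mono step) auto
      also have "\<dots> \<le> \<epsilon> n * norm D1 * ((1 + \<eta>) * norm d * norm (a - b)) + norm D1 * (\<eta> * norm d * norm (a - b))"
        using \<epsilon>0 \<eta>0 by (intro add_mono mult_left_mono lip[OF a b]) auto
      also have "\<dots> = ((1 + \<epsilon> n) * (1 + \<eta>) - 1) * N"
        by (simp add: N_def algebra_simps)
      also have "\<dots> \<le> \<epsilon> (Suc n) * N" using budget N0 by (intro mult_right_mono) auto
      finally show ?thesis by (simp add: N_def norm_mult mult_ac)
    qed
    then show ?case using D10 d0 g unfolding D W by auto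
  qed
  then show "D \<noteq> 0" "norm W * 64 ^ n \<le> norm z * norm D"
    "\<And>a b. \<lbrakk>norm (a - z) * norm D * (1 + \<epsilon> n) \<le> norm W / 24; 
             norm (b - z) * norm D * (1 + \<epsilon> n) \<le> norm W / 24\<rbrakk> \<Longrightarrow>
       norm ((f ^^ n) a - (f ^^ n) b - D * (a - b)) \<le> \<epsilon> n * norm D * norm (a - b)"
    by blast+
qed

lemma set_B_iterate_pullback:
  assumes f: "f holomorphic_on UNIV" and z: "\<forall>k<n. (f ^^ k) z \<in> set_B \<beta> f"
    and w: "norm (w - (f ^^ n) z) < t * norm ((f ^^ n) z)" and t: "t \<le> 1 / 2"
  shows "\<exists>a. (f ^^ n) a = w \<and> norm (a - z) < t / 10 ^ n * norm z"
  using z w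
proof (induction n arbitrary: z)
  case 0
  then show ?case by auto
next
  case (Suc n)
  note orb = funpow_orbit_Suc[OF Suc.prems(1)]
  have eq: "(f ^^ Suc n) = (f ^^ n) \<circ> f" by (rule funpow_Suc_right)
  obtain a1 where a1: "(f ^^ n) a1 = w" "norm (a1 - f z) < t / 10 ^ n * norm (f z)"
    using Suc.IH[OF orb(2)] Suc.prems(2) by (auto simp only: eq o_apply)
  have "0 < t * norm ((f ^^ Suc n) z)" using Suc.prems(2) by (meson norm_ge_zero order_le_less_trans)
  then have "0 < t" by (smt (verit) norm_ge_zero zero_less_mult_iff)
  then have "t / 10 ^ n \<le> t" by (simp add: divide_le_eq mult_le_cancel_left1)
  then have "t / 10 ^ n \<le> 1 / 2" using t by linarith
  from set_B_pullback[OF f orb(1) a1(2) this] obtain a where "f a = a1" "norm (a - z) < t / 10 ^ n / 10 * norm z"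
    by blast
  then show ?case using a1(1) by (intro exI[of _ a]) (simp add: eq mult.commute del: funpow.simps)
qed

text \<open>
The last step reaches the whole circle from a disk that the previous steps pull back to an exponentially
small neighbourhood of \<open>z\<close>.
\<close>

lemma set_B_iterate_circle:
  assumes f: "f holomorphic_on UNIV" and z: "\<forall>k\<le>n. (f ^^ k) z \<in> set_B \<beta> f"
    and w: "norm w = norm ((f ^^ Suc n) z)"
  shows "\<exists>a. (f ^^ Suc n) a = w \<and> norm (a - z) < 1 / 2 / 10 ^ n * norm z"
proof -
  have "(f ^^ n) z \<in> set_B \<beta> f" using z by blast
  from set_B_circle[OF f this, of w] w obtain b where b: "f b = w" "norm (b - (f ^^ n) z) < 1 / 2 * norm ((f ^^ n) z)"
    by auto
  have z': "\<forall>k<n. (f ^^ k) z \<in> set_B \<beta> f" using z by simp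
  obtain a where "(f ^^ n) a = b" "norm (a - z) < 1 / 2 / 10 ^ n * norm z"
    using set_B_iterate_pullback[OF f z' b(2)] by auto
  then show ?thesis using b(1) by auto
qed

section \<open>The measure of the points that leave \<open>B\<close>\<close>

text \<open>
A substitute for the change of variables formula: if \<open>F\<close> contracts distances by at most the factor \<open>1 / c\<close>
on \<open>S\<close>, then the outer measure of \<open>S\<close> is at most of the order \<open>c\<^sup>2\<close> times the measure of a
set containing \<open>F ` S\<close>. Cover that set efficiently by non-overlapping squares; the preimage of a
square of side \<open>s\<close> has diameter at most \<open>\<surd>2 c s\<close>. As \<open>S\<close> may fail to be measurable, the bound is
stated for a measurable cover \<open>T\<close>.
\<close>

lemma expanding_preimage_cover:
  fixes F :: "complex \<Rightarrow> complex"
  assumes E: "E \<in> lmeasurable" "bounded E" and FS: "F ` S \<subseteq> E" and c: "0 \<le> c" and e: "0 < e"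
    and exp: "\<And>a b. a \<in> S \<Longrightarrow> b \<in> S \<Longrightarrow> norm (a - b) \<le> c * norm (F a - F b)"
  obtains T where "T \<in> lmeasurable" "S \<subseteq> T" "measure lebesgue T \<le> 8 * c\<^sup>2 * (measure lebesgue E + e)"
proof -
  obtain r where r: "0 < r" "E \<subseteq> cball 0 r"
    using E(2) by (metis bounded_subset_ballD ball_subset_cball subset_trans)
  define p q where "p = Complex (-r) (-r)" and "q = Complex r r"
  have "E \<subseteq> cbox p q"
  proof
    fix x assume "x \<in> E"
    then have "norm x \<le> r" using r by auto
    then show "x \<in> cbox p q"
      using abs_Re_le_cmod[of x] abs_Im_le_cmod[of x]
      by (auto simp: in_cbox_complex_iff p_def q_def)
  qed
  from measurable_outer_intervals_bounded[OF E(1) this e]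
  obtain \<D> where \<D>: "countable \<D>"
    "\<And>K. K \<in> \<D> \<Longrightarrow> K \<subseteq> cbox p q \<and> K \<noteq> {} \<and> (\<exists>u v. K = cbox u v)"
    "pairwise (\<lambda>A B. interior A \<inter> interior B = {}) \<D>"
    "\<And>u v. cbox u v \<in> \<D> \<Longrightarrow> \<exists>n. \<forall>i \<in> Basis. v \<bullet> i - u \<bullet> i = (q \<bullet> i - p \<bullet> i)/2^n"
    "E \<subseteq> \<Union>\<D>" "\<Union>\<D> \<in> lmeasurable" "measure lebesgue (\<Union>\<D>) \<le> measure lebesgue E + e"
    by metis
  have ex: "\<exists>T. T \<in> lmeasurable \<and> {a \<in> S. F a \<in> K} \<subseteq> T \<and> measure lebesgue T \<le> 8 * c\<^sup>2 * measure lebesgue K"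
    if K: "K \<in> \<D>" for K
  proof (cases "{a \<in> S. F a \<in> K} = {}")
    case True
    then show ?thesis by (intro exI[of _ "{}"]) auto
  next
    case False
    then obtain a0 where a0: "a0 \<in> S" "F a0 \<in> K" by blast
    obtain u v where uv: "K = cbox u v" using \<D>(2)[OF K] by blast
    obtain n where n: "\<forall>i \<in> Basis. v \<bullet> i - u \<bullet> i = (q \<bullet> i - p \<bullet> i)/2^n"
      using \<D>(4) K uv by blast
    define s where "s = 2 * r / 2 ^ n"
    have s0: "s > 0" using r by (simp add: s_def)
    have side: "Re v - Re u = s" "Im v - Im u = s"
      using n by (auto simp: Basis_complex_def s_def p_def q_def inner_complex_def)
    have mK: "measure lebesgue K = s\<^sup>2"
    proof -
      have "\<forall>i\<in>Basis. u \<bullet> i \<le> v \<bullet> i"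
        using side s0 by (auto simp: Basis_complex_def inner_complex_def)
      from content_cbox[OF this] have "measure lborel (cbox u v) = s * s"
        using side by (simp add: Basis_complex_def inner_complex_def)
      then show ?thesis unfolding uv by (simp add: power2_eq_square)
    qed
    have "{a \<in> S. F a \<in> K} \<subseteq> cball a0 (c * (sqrt 2 * s))"
    proof clarify
      fix a assume a: "a \<in> S" "F a \<in> K"
      have "\<bar>Re (F a - F a0)\<bar> \<le> s" "\<bar>Im (F a - F a0)\<bar> \<le> s"
        using a(2) a0(2) side unfolding uv by (auto simp: in_cbox_complex_iff)
      then have "(Re (F a - F a0))\<^sup>2 \<le> s\<^sup>2" "(Im (F a - F a0))\<^sup>2 \<le> s\<^sup>2"
        using s0 by (simp_all add: abs_le_square_iff[symmetric])
      then have "(norm (F a - F a0))\<^sup>2 \<le> (sqrt 2 * s)\<^sup>2"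
        by (simp add: cmod_power2 power_mult_distrib)
      then have "norm (F a - F a0) \<le> sqrt 2 * s"
        using s0 by (intro power2_le_imp_le[of "norm (F a - F a0)"]) auto
      then have "norm (a - a0) \<le> c * (sqrt 2 * s)"
        using exp[OF a(1) a0(1)] c by (meson mult_left_mono order_trans)
      then show "a \<in> cball a0 (c * (sqrt 2 * s))" by (simp add: dist_norm norm_minus_commute)
    qed
    moreover have "measure lebesgue (cball a0 (c * (sqrt 2 * s))) = pi * (c * (sqrt 2 * s))\<^sup>2"
      using c s0 by (simp add: content_cball unit_ball_vol_2)
    moreover have "pi * (c * (sqrt 2 * s))\<^sup>2 \<le> 8 * c\<^sup>2 * s\<^sup>2"
      using mult_right_mono[OF less_imp_le[OF pi_less_4], of "2 * c\<^sup>2 * s\<^sup>2"]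
      by (simp add: power_mult_distrib)
    ultimately show ?thesis using mK by (intro exI[of _ "cball a0 (c * (sqrt 2 * s))"]) auto
  qed
  then have "\<exists>T. \<forall>K\<in>\<D>. T K \<in> lmeasurable \<and> {a \<in> S. F a \<in> K} \<subseteq> T K \<and>
      measure lebesgue (T K) \<le> 8 * c\<^sup>2 * measure lebesgue K"
    by (intro bchoice) blast
  then obtain T where T: "\<And>K. K \<in> \<D> \<Longrightarrow> T K \<in> lmeasurable"
    "\<And>K. K \<in> \<D> \<Longrightarrow> {a \<in> S. F a \<in> K} \<subseteq> T K"
    "\<And>K. K \<in> \<D> \<Longrightarrow> measure lebesgue (T K) \<le> 8 * c\<^sup>2 * measure lebesgue K"
    by blast
  have bound: "measure lebesgue (\<Union>K\<in>\<D>'. T K) \<le> 8 * c\<^sup>2 * (measure lebesgue E + e)"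
    if \<D>': "\<D>' \<subseteq> \<D>" "finite \<D>'" for \<D>'
  proof -
    have "measure lebesgue (\<Union>K\<in>\<D>'. T K) \<le> (\<Sum>K\<in>\<D>'. measure lebesgue (T K))"
      using \<D>' T(1) by (intro measure_UNION_le) (auto dest: fmeasurableD)
    also have "\<dots> \<le> (\<Sum>K\<in>\<D>'. 8 * c\<^sup>2 * measure lebesgue K)"
      using \<D>' T(3) by (intro sum_mono) auto
    also have "\<dots> = 8 * c\<^sup>2 * (\<Sum>K\<in>\<D>'. measure lebesgue K)" by (simp add: sum_distrib_left)
    also have "(\<Sum>K\<in>\<D>'. measure lebesgue K) = measure lebesgue (\<Union>\<D>')"
    proof -
      have "\<D>' division_of \<Union>\<D>'"
      proof (rule division_ofI)
        fix K assume K: "K \<in> \<D>'"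
        show "K \<subseteq> \<Union>\<D>'" "K \<noteq> {}" "\<exists>a b. K = cbox a b"
          using K \<D>(2)[of K] \<D>' by blast+
        fix K' assume "K' \<in> \<D>'" "K \<noteq> K'"
        then show "interior K \<inter> interior K' = {}"
          using K \<D>(3) \<D>'(1) unfolding pairwise_def by blast
      qed (use \<D>' in auto)
      then show ?thesis by (rule content_division)
    qed
    also have "measure lebesgue (\<Union>\<D>') \<le> measure lebesgue (\<Union>\<D>)"
    proof (rule measure_mono_fmeasurable)
      have "K \<in> sets lebesgue" if "K \<in> \<D>'" for K
        using \<D>(2)[of K] that \<D>' by fastforce
      then show "\<Union>\<D>' \<in> sets lebesgue" using \<D>' by (intro sets.finite_Union) auto
    qed (use \<D>' \<D>(6) in auto)
    also have "\<dots> \<le> measure lebesgue E + e" by (rule \<D>(7))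
    finally show ?thesis by (simp add: mult_left_mono)
  qed
  show ?thesis
  proof (rule that)
    show "(\<Union>K\<in>\<D>. T K) \<in> lmeasurable"
      by (rule fmeasurable_UN_bound[OF \<D>(1) T(1) bound])
    show "measure lebesgue (\<Union>K\<in>\<D>. T K) \<le> 8 * c\<^sup>2 * (measure lebesgue E + e)"
      by (rule measure_UN_bound[OF \<D>(1) T(1) bound])
    show "S \<subseteq> (\<Union>K\<in>\<D>. T K)" using FS \<D>(5) T(2) by blast
  qed
qed

definition annulus :: "real \<Rightarrow> complex set" where
  "annulus r = {z. r / 2 < norm z \<and> norm z < 2 * r}"

text \<open>
Since a set that is not measurable has \<open>measure\<close> zero, a density bound with \<open>a < 1\<close> also shows that
\<open>B\<close> is measurable in the annulus.
\<close>

lemma annulus_minus_measure: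
  assumes s: "0 < s" and a: "a < 1" and d: "1 - a \<le> dens B (annulus s)"
  shows "annulus s - B \<in> lmeasurable" "measure lebesgue (annulus s - B) \<le> 16 * a * s\<^sup>2"
proof -
  have sub: "annulus s \<subseteq> ball 0 (2 * s)" by (auto simp: annulus_def)
  have "annulus s = ball 0 (2 * s) - cball 0 (s / 2)" by (auto simp: annulus_def)
  then have An: "annulus s \<in> lmeasurable" by (simp add: fmeasurable_Diff fmeasurableD)
  define m where "m = measure lebesgue (annulus s)"
  have nz: "measure lebesgue (B \<inter> annulus s) \<noteq> 0"
    using d a by (auto simp: dens_def)
  then have "B \<inter> annulus s \<in> sets lebesgue" using measure_notin_sets by blast
  then have BA: "B \<inter> annulus s \<in> lmeasurable" using An by (rule fmeasurableI2[rotated 2]) auto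
  have m0: "0 < m" using d a unfolding m_def dens_def
    by (metis diff_gt_0_iff_gt div_by_0 linorder_not_le zero_less_measure_iff)
  have eq: "annulus s - B = annulus s - B \<inter> annulus s" by blast
  show "annulus s - B \<in> lmeasurable" unfolding eq using An BA by (rule fmeasurable.Diff)
  have "measure lebesgue (annulus s - B) = m - measure lebesgue (B \<inter> annulus s)"
    unfolding eq m_def using An BA by (intro measurable_measure_Diff) (auto dest: fmeasurableD)
  also have "\<dots> \<le> a * m"
  proof -
    have "(1 - a) * m \<le> measure lebesgue (B \<inter> annulus s)"
      using d m0 by (simp add: dens_def m_def[symmetric] pos_le_divide_eq)
    then show ?thesis by (simp add: algebra_simps)
  qed
  also have "\<dots> \<le> a * (16 * s\<^sup>2)"
  proof (rule mult_left_mono)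
    have "m \<le> measure lebesgue (ball 0 (2 * s) :: complex set)"
      unfolding m_def using sub An by (intro measure_mono_fmeasurable) (auto dest: fmeasurableD)
    also have "\<dots> = pi * (4 * s\<^sup>2)" using s by (simp add: content_ball unit_ball_vol_2 power_mult_distrib)
    also have "\<dots> \<le> 4 * (4 * s\<^sup>2)" using pi_less_4 by (intro mult_right_mono) auto
    finally show "m \<le> 16 * s\<^sup>2" by simp
    have "measure lebesgue (B \<inter> annulus s) \<le> m"
      unfolding m_def using An BA by (intro measure_mono_fmeasurable) (auto dest: fmeasurableD)
    with \<open>m - measure lebesgue (B \<inter> annulus s) \<le> a * m\<close> m0 show "0 \<le> a"
      by (smt (verit) mult_neg_pos)
  qed
  finally show "measure lebesgue (annulus s - B) \<le> 16 * a * s\<^sup>2" by simp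
qed

text \<open>
The key estimate. Let \<open>D\<close> be the derivative of the \<open>n\<close>-th iterate at \<open>z\<close>, and \<open>W\<close> its value.
On the disk of radius \<open>\<bar>W\<bar> / (36 \<bar>D\<bar>)\<close> around \<open>z\<close> the iterate maps into the annulus of
\<open>\<bar>W\<bar>\<close> and distances grow by a factor of at least \<open>\<bar>D\<bar> / 2\<close>. So the points of \<open>N\<close> in this disk
have outer measure at most of the order \<open>A \<bar>W\<bar>\<^sup>2 / \<bar>D\<bar>\<^sup>2\<close>, which is comparable to \<open>A\<close> times the area of the
disk. The Vitali lemma picks countably many of these disks that cover \<open>N\<close>, while the concentric disks of
one fifth of the radius, \<open>\<rho> = \<bar>W\<bar> / (180 \<bar>D\<bar>)\<close>, are disjoint subsets of the disk of radius \<open>3 r\<close>.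
The constant is \<open>18662400 = 64 \<sqdot> 180\<^sup>2 \<sqdot> 9\<close>.
\<close>

lemma first_exit_cover:
  assumes f: "f holomorphic_on UNIV" and r: "0 < r" and A: "0 < A"
    and N: "\<And>z. z \<in> N \<Longrightarrow> norm z < 2 * r"
    and orb: "\<And>z k. z \<in> N \<Longrightarrow> k < n \<Longrightarrow> (f ^^ k) z \<in> set_B \<beta> f"
    and out: "\<And>z. z \<in> N \<Longrightarrow> (f ^^ n) z \<notin> set_B \<beta> f"
    and nz: "\<And>z. z \<in> N \<Longrightarrow> (f ^^ n) z \<noteq> 0"
    and E: "\<And>z. z \<in> N \<Longrightarrow> annulus (norm ((f ^^ n) z)) - set_B \<beta> f \<in> lmeasurable"
    and mE: "\<And>z. z \<in> N \<Longrightarrow> measure lebesgue (annulus (norm ((f ^^ n) z)) - set_B \<beta> f)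
                 \<le> A * (norm ((f ^^ n) z))\<^sup>2"
  shows "\<exists>T. T \<in> lmeasurable \<and> N \<subseteq> T \<and> measure lebesgue T \<le> 18662400 * A * r\<^sup>2"
proof -
  define W where "W = (\<lambda>z. (f ^^ n) z)"
  define D where "D = (\<lambda>z. deriv (f ^^ n) z)"
  define \<rho> where "\<rho> = (\<lambda>z. norm (W z) / (180 * norm (D z)))"
  define \<epsilon> where "\<epsilon> = (\<lambda>n::nat. (1 - (1 / 2) ^ n) / (2::real))"
  have D0: "D z \<noteq> 0" and gr: "norm (W z) * 64 ^ n \<le> norm z * norm (D z)" if "z \<in> N" for z
    using set_B_iterate(1,2)[OF f _ refl refl, where z=z and n=n] orb[OF that]
    unfolding D_def W_def by blast+
  have \<rho>0: "0 < \<rho> z" if "z \<in> N" for z using D0 nz that by (simp add: \<rho>_def W_def)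
  have \<rho>r: "\<rho> z \<le> r" if z: "z \<in> N" for z
  proof -
    have "norm (W z) * 1 \<le> norm (W z) * 64 ^ n" by (intro mult_left_mono) auto
    also have "\<dots> \<le> norm z * norm (D z)" by (rule gr[OF z])
    also have "\<dots> \<le> 2 * r * norm (D z)" using N[OF z] by (intro mult_right_mono) auto
    finally have "norm (W z) \<le> r * norm (D z) * 2" by simp
    moreover have "0 \<le> r * norm (D z)" using r by simp
    ultimately have "norm (W z) \<le> r * (180 * norm (D z))" by linarith
    then show ?thesis using D0[OF z] by (simp add: \<rho>_def pos_divide_le_eq)
  qed
  have dist: "norm (W a - W b - D z * (a - b)) \<le> 1 / 2 * norm (D z) * norm (a - b)"
    if z: "z \<in> N" and a: "a \<in> cball z (5 * \<rho> z)" and b: "b \<in> cball z (5 * \<rho> z)" for z a b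
  proof -
    have \<epsilon>: "\<epsilon> n \<le> 1 / 2" by (simp add: \<epsilon>_def)
    have dom: "norm (a - z) * norm (D z) * (1 + \<epsilon> n) \<le> norm (W z) / 24"
      if a: "a \<in> cball z (5 * \<rho> z)" for a
    proof -
      have "norm (a - z) \<le> 5 * \<rho> z" using a by (simp add: dist_norm norm_minus_commute)
      then have "norm (a - z) * norm (D z) * (1 + \<epsilon> n) \<le> 5 * \<rho> z * norm (D z) * (3 / 2)"
        using \<epsilon> \<rho>0[OF z] by (intro mult_mono) (auto simp: \<epsilon>_def power_le_one)
      also have "\<dots> = norm (W z) / 24" using D0[OF z] by (simp add: \<rho>_def)
      finally show ?thesis .
    qed
    have "norm (W a - W b - D z * (a - b)) \<le> \<epsilon> n * norm (D z) * norm (a - b)"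
      using set_B_iterate(3)[OF f _ refl refl, where z=z and n=n and a=a and b=b] orb[OF z]
        dom[OF a] dom[OF b]
      unfolding D_def W_def \<epsilon>_def by blast
    also have "\<dots> \<le> 1 / 2 * norm (D z) * norm (a - b)" using \<epsilon> by (intro mult_right_mono) auto
    finally show ?thesis .
  qed
  have loc: "\<exists>T. T \<in> lmeasurable \<and> N \<inter> cball z (5 * \<rho> z) \<subseteq> T \<and> measure lebesgue T \<le> 2073600 * A * (\<rho> z)\<^sup>2"
    if z: "z \<in> N" for z
  proof -
    define E where "E = annulus (norm (W z)) - set_B \<beta> f"
    define S where "S = N \<inter> cball z (5 * \<rho> z)"
    have W0: "0 < norm (W z)" and dD: "0 < norm (D z)" using nz[OF z] D0[OF z] by (auto simp: W_def)
    have zz: "z \<in> cball z (5 * \<rho> z)" using \<rho>0[OF z] by simp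
    have "bounded (annulus (norm (W z)))"
      by (rule bounded_subset[OF bounded_ball[of 0 "2 * norm (W z)"]]) (auto simp: annulus_def)
    then have E: "E \<in> lmeasurable" "bounded E"
      using E[OF z] by (auto simp: E_def W_def intro: bounded_subset)
    have FS: "W ` S \<subseteq> E"
    proof clarify
      fix a assume a: "a \<in> S"
      then have ac: "a \<in> cball z (5 * \<rho> z)" by (simp add: S_def)
      have "norm (W a - W z) \<le> norm (D z * (a - z)) + norm (W a - W z - D z * (a - z))"
        by (rule norm_triangle_sub)
      also have "\<dots> \<le> 3 / 2 * (norm (D z) * norm (a - z))"
        using dist[OF z ac zz] by (simp add: norm_mult)
      also have "\<dots> \<le> 3 / 2 * (norm (D z) * (5 * \<rho> z))"
        using ac by (intro mult_left_mono) (auto simp: dist_norm norm_minus_commute)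
      also have "\<dots> < norm (W z) / 2" using W0 dD by (simp add: \<rho>_def)
      finally have "norm (W a - W z) < norm (W z) / 2" .
      moreover have "norm (W a) \<le> norm (W z) + norm (W a - W z)" by (rule norm_triangle_sub)
      moreover have "norm (W z) \<le> norm (W a) + norm (W a - W z)" by (metis norm_minus_commute norm_triangle_sub)
      ultimately have "W a \<in> annulus (norm (W z))" using W0 by (simp add: annulus_def)
      then show "W a \<in> E" using out[of a] a by (simp add: E_def S_def W_def)
    qed
    have ex: "norm (a - b) \<le> 2 / norm (D z) * norm (W a - W b)" if "a \<in> S" "b \<in> S" for a b
    proof -
      have "norm (D z * (a - b)) \<le> norm (W a - W b) + norm (W a - W b - D z * (a - b))"
        by (metis norm_minus_commute norm_triangle_sub)
      then have "norm (D z) * norm (a - b) \<le> 2 * norm (W a - W b)"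
        using dist[OF z, of a b] that by (simp add: S_def norm_mult)
      then show ?thesis using dD by (simp add: field_simps)
    qed
    \<comment> \<open>the slack \<open>e\<close> of the cover is taken as large as the bound on the measure of \<open>E\<close>\<close>
    obtain T where T: "T \<in> lmeasurable" "S \<subseteq> T"
      "measure lebesgue T \<le> 8 * (2 / norm (D z))\<^sup>2 * (measure lebesgue E + A * (norm (W z))\<^sup>2)"
      using expanding_preimage_cover[OF E FS _ _ ex, of "A * (norm (W z))\<^sup>2"] W0 A by auto
    note T(3)
    also have "8 * (2 / norm (D z))\<^sup>2 * (measure lebesgue E + A * (norm (W z))\<^sup>2) \<le>
        8 * (2 / norm (D z))\<^sup>2 * (A * (norm (W z))\<^sup>2 + A * (norm (W z))\<^sup>2)"
      using mE[OF z] by (intro mult_left_mono) (auto simp: E_def W_def)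
    also have "\<dots> = 2073600 * A * (\<rho> z)\<^sup>2"
      using dD by (simp add: \<rho>_def power_divide power_mult_distrib)
    finally show ?thesis using T(1,2) unfolding S_def by blast
  qed
  then have "\<exists>T. \<forall>z\<in>N. T z \<in> lmeasurable \<and> N \<inter> cball z (5 * \<rho> z) \<subseteq> T z \<and>
      measure lebesgue (T z) \<le> 2073600 * A * (\<rho> z)\<^sup>2"
    by (intro bchoice) blast
  then obtain T where T: "\<And>z. z \<in> N \<Longrightarrow> T z \<in> lmeasurable"
    "\<And>z. z \<in> N \<Longrightarrow> N \<inter> cball z (5 * \<rho> z) \<subseteq> T z"
    "\<And>z. z \<in> N \<Longrightarrow> measure lebesgue (T z) \<le> 2073600 * A * (\<rho> z)\<^sup>2"
    by blast
  have "N \<subseteq> (\<Union>z\<in>N. cball z (\<rho> z))" using \<rho>0 by (force intro: less_imp_le)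
  then obtain C where C: "countable C" "C \<subseteq> N"
     "pairwise (\<lambda>i j. disjnt (cball i (\<rho> i)) (cball j (\<rho> j))) C"
     "N \<subseteq> (\<Union>i\<in>C. cball i (5 * \<rho> i))"
    by (rule Vitali_covering_lemma_cballs[where a = "\<lambda>z. z" and B = r]) (use \<rho>0 \<rho>r in auto)
  have bound: "measure lebesgue (\<Union>z\<in>C'. T z) \<le> 18662400 * A * r\<^sup>2"
    if C': "C' \<subseteq> C" "finite C'" for C'
  proof -
    have CN: "z \<in> N" if "z \<in> C'" for z using that C' C by blast
    have sq: "pi * (\<rho> z)\<^sup>2 = measure lebesgue (cball z (\<rho> z))" if "z \<in> C'" for z
      using \<rho>0[OF CN[OF that]] by (simp add: content_cball unit_ball_vol_2)
    have "pi * (\<Sum>z\<in>C'. (\<rho> z)\<^sup>2) = (\<Sum>z\<in>C'. measure lebesgue (cball z (\<rho> z)))"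
      using sq by (simp add: sum_distrib_left)
    also have "\<dots> = measure lebesgue (\<Union>z\<in>C'. cball z (\<rho> z))"
    proof (rule measure_finite_Union[symmetric])
      show "disjoint_family_on (\<lambda>z. cball z (\<rho> z)) C'"
        using C(3) C'(1) unfolding disjoint_family_on_def pairwise_def disjnt_def by blast
      show "(\<lambda>z. cball z (\<rho> z)) ` C' \<subseteq> sets lebesgue" by auto
      show "\<And>i. i \<in> C' \<Longrightarrow> emeasure lebesgue (cball i (\<rho> i)) \<noteq> \<infinity>"
        using emeasure_lborel_cball_finite by (simp add: less_top[symmetric])
    qed (fact C'(2))
    also have "\<dots> \<le> measure lebesgue (cball 0 (3 * r) :: complex set)"
    proof (rule measure_mono_fmeasurable)
      show "(\<Union>z\<in>C'. cball z (\<rho> z)) \<subseteq> cball 0 (3 * r)"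
      proof clarify
        fix z a assume z: "z \<in> C'" and a: "a \<in> cball z (\<rho> z)"
        have "norm a \<le> norm z + norm (a - z)" by (rule norm_triangle_sub)
        then show "a \<in> cball 0 (3 * r)"
          using a \<rho>r[OF CN[OF z]] N[OF CN[OF z]] by (simp add: dist_norm norm_minus_commute)
      qed
      show "(\<Union>z\<in>C'. cball z (\<rho> z)) \<in> sets lebesgue" using C' by (intro sets.finite_UN) auto
    qed auto
    also have "\<dots> = pi * (9 * r\<^sup>2)" using r by (simp add: content_cball unit_ball_vol_2 power_mult_distrib)
    finally have sum: "(\<Sum>z\<in>C'. (\<rho> z)\<^sup>2) \<le> 9 * r\<^sup>2" by simp
    have "measure lebesgue (\<Union>z\<in>C'. T z) \<le> (\<Sum>z\<in>C'. measure lebesgue (T z))"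
      using C' T(1) CN by (intro measure_UNION_le) (auto dest: fmeasurableD)
    also have "\<dots> \<le> (\<Sum>z\<in>C'. 2073600 * A * (\<rho> z)\<^sup>2)"
      using T(3) CN by (intro sum_mono) auto
    also have "\<dots> = 2073600 * A * (\<Sum>z\<in>C'. (\<rho> z)\<^sup>2)" by (simp add: sum_distrib_left)
    also have "\<dots> \<le> 2073600 * A * (9 * r\<^sup>2)" using sum A by (intro mult_left_mono) auto
    finally show ?thesis by simp
  qed
  have TC: "\<And>z. z \<in> C \<Longrightarrow> T z \<in> lmeasurable" using T(1) C(2) by blast
  have "(\<Union>z\<in>C. T z) \<in> lmeasurable" by (rule fmeasurable_UN_bound[OF C(1) TC bound])
  moreover have "measure lebesgue (\<Union>z\<in>C. T z) \<le> 18662400 * A * r\<^sup>2"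
    by (rule measure_UN_bound[OF C(1) TC bound])
  moreover have "N \<subseteq> (\<Union>z\<in>C. T z)" using C(2,4) T(2) by blast
  ultimately show ?thesis by blast
qed

text \<open>
If the orbit of \<open>r0\<close> were bounded, then \<open>\<alpha>\<close>, being positive and decreasing, would be bounded away from
\<open>0\<close> along it, and the series would diverge. As \<open>\<beta>\<close> is increasing, the orbit is monotone, and being
unbounded it must increase.
\<close>

lemma iterates_tendsto_infinity:
  fixes \<alpha> \<beta> :: "real \<Rightarrow> real"
  assumes \<beta>_pos: "\<forall>x>0. \<beta> x > 0" and \<beta>_incr: "mono_on {0<..} \<beta>"
    and \<alpha>_pos: "\<forall>x>0. \<alpha> x > 0" and \<alpha>_decr: "antimono_on {0<..} \<alpha>"
    and r0: "0 < r0" and sum: "summable (\<lambda>n. \<alpha> ((\<beta> ^^ n) r0))"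
  shows "\<And>n. 0 < (\<beta> ^^ n) r0" "incseq (\<lambda>n. (\<beta> ^^ n) r0)" "filterlim (\<lambda>n. (\<beta> ^^ n) r0) at_top sequentially"
proof -
  define b where "b = (\<lambda>n. (\<beta> ^^ n) r0)"
  have b0: "0 < b n" for n by (induction n) (use r0 \<beta>_pos in \<open>auto simp: b_def\<close>)
  have unb: "\<exists>n. M < b n" if M: "0 < M" for M
  proof (rule ccontr)
    assume "\<not> (\<exists>n. M < b n)"
    then have "\<alpha> M \<le> \<alpha> (b n)" for n
      using \<alpha>_decr b0[of n] M by (simp add: monotone_on_def not_less)
    moreover have "(\<lambda>n. \<alpha> (b n)) \<longlonglongrightarrow> 0" using sum unfolding b_def by (rule summable_LIMSEQ_zero)
    ultimately have "\<alpha> M \<le> 0" by (intro LIMSEQ_le_const) auto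
    then show False using \<alpha>_pos M by force
  qed
  have bSuc: "b (Suc n) = \<beta> (b n)" for n by (simp add: b_def)
  have "b 0 \<le> b 1"
  proof (rule ccontr)
    assume neg: "\<not> b 0 \<le> b 1"
    have "b (Suc n) \<le> b n" for n
    proof (induction n)
      case (Suc n)
      then have "\<beta> (b (Suc n)) \<le> \<beta> (b n)" using b0 by (intro mono_onD[OF \<beta>_incr]) auto
      then show ?case by (simp only: bSuc)
    qed (use neg in simp)
    then have "b n \<le> b 0" for n using lift_Suc_antimono_le[of b 0 n] by simp
    then show False using unb[OF b0[of 0]] by (meson not_less)
  qed
  then have "b n \<le> b (Suc n)" for n
  proof (induction n)
    case (Suc n)
    then have "\<beta> (b n) \<le> \<beta> (b (Suc n))" using b0 by (intro mono_onD[OF \<beta>_incr]) auto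
    then show ?case by (simp only: bSuc)
  qed simp
  then have inc: "incseq b" by (rule incseq_SucI)
  show "0 < (\<beta> ^^ n) r0" for n using b0 by (simp add: b_def)
  show "incseq (\<lambda>n. (\<beta> ^^ n) r0)" using inc by (simp add: b_def)
  have "filterlim b at_top sequentially"
    unfolding filterlim_at_top eventually_sequentially
  proof
    fix Z :: real
    have "0 < max Z 1" by simp
    then obtain N where N: "max Z 1 < b N" using unb by blast
    have "Z \<le> b n" if "n \<ge> N" for n using N incseqD[OF inc that] by linarith
    then show "\<exists>N. \<forall>n\<ge>N. Z \<le> b n" by blast
  qed
  then show "filterlim (\<lambda>n. (\<beta> ^^ n) r0) at_top sequentially" by (simp add: b_def)
qed

lemma set_B_orbit_growth:
  assumes \<beta>_pos: "\<forall>x>0. \<beta> x > 0" and \<beta>_incr: "mono_on {0<..} \<beta>" and r: "0 < r" "r \<le> norm z"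
    and B: "\<forall>k<n. (f ^^ k) z \<in> set_B \<beta> f"
  shows "(\<beta> ^^ n) r \<le> norm ((f ^^ n) z)"
  using B
proof (induction n)
  case 0
  then show ?case using r by simp
next
  case (Suc n)
  have b0: "0 < (\<beta> ^^ m) r" for m by (induction m) (use r \<beta>_pos in auto)
  have le: "(\<beta> ^^ n) r \<le> norm ((f ^^ n) z)" using Suc by simp
  have "\<beta> ((\<beta> ^^ n) r) \<le> \<beta> (norm ((f ^^ n) z))"
    using b0[of n] le by (intro mono_onD[OF \<beta>_incr]) auto
  also have "\<dots> < norm (f ((f ^^ n) z))"
    using set_B_basic(5)[of "(f ^^ n) z" \<beta> f] Suc.prems by simp
  finally show ?case by simp
qed

text \<open>
Every point of the ring that leaves \<open>B\<close> does so for a first time. At a point that leaves at step \<open>n\<close> the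
\<open>n\<close>-th iterate has modulus at least \<open>\<beta>\<^sup>n(r)\<close>; so these points have measure \<open>O(\<alpha>(\<beta>\<^sup>n(r)) r\<^sup>2)\<close>. The
smallness assumption makes the total at most \<open>r\<^sup>2\<close>, as \<open>16 \<sqdot> 18662400 < 10\<^sup>9\<close>, and the area of the ring is \<open>3 \<pi> r\<^sup>2\<close>.
\<close>

lemma set_B_orbits_positive_measure:
  fixes \<alpha> \<beta> :: "real \<Rightarrow> real"
  assumes f: "f holomorphic_on UNIV"
    and \<beta>_pos: "\<forall>x>0. \<beta> x > 0" and \<beta>_incr: "mono_on {0<..} \<beta>"
    and \<alpha>_pos: "\<forall>x>0. \<alpha> x > 0" and \<alpha>_decr: "antimono_on {0<..} \<alpha>"
    and r: "0 < r" and sum: "summable (\<lambda>n. \<alpha> ((\<beta> ^^ n) r))"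
    and small: "(\<Sum>n. \<alpha> ((\<beta> ^^ n) r)) < 1 / 10 ^ 9"
    and inc: "incseq (\<lambda>n. (\<beta> ^^ n) r)"
    and dens: "\<And>s. s \<ge> r \<Longrightarrow> 1 - \<alpha> s \<le> dens (set_B \<beta> f) (annulus s)"
  shows "\<exists>S. S \<in> lmeasurable \<and> 0 < measure lebesgue S \<and>
    (\<forall>z\<in>S. r \<le> norm z \<and> (\<forall>k. (f ^^ k) z \<in> set_B \<beta> f))"
proof -
  define b where "b = (\<lambda>n. (\<beta> ^^ n) r)"
  define K where "K = {z::complex. r < norm z \<and> norm z < 2 * r}"
  define N where "N = (\<lambda>n. {z \<in> K. (\<forall>k<n. (f ^^ k) z \<in> set_B \<beta> f) \<and> (f ^^ n) z \<notin> set_B \<beta> f})"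
  have rb: "r \<le> b n" for n using incseqD[OF inc, of 0 n] by (simp add: b_def)
  have \<alpha>b: "0 < \<alpha> (b n)" for n using \<alpha>_pos rb[of n] r by force
  have \<alpha>1: "\<alpha> (b n) < 1" for n
  proof -
    have "\<alpha> (b n) = (\<Sum>i\<in>{n}. \<alpha> (b i))" by simp
    also have "\<dots> \<le> (\<Sum>i. \<alpha> (b i))"
      using sum \<alpha>b by (intro sum_le_suminf) (auto simp: b_def less_imp_le)
    finally show ?thesis using small by (simp add: b_def)
  qed
  have ex: "\<exists>T. T \<in> lmeasurable \<and> N n \<subseteq> T \<and> measure lebesgue T \<le> 18662400 * (16 * \<alpha> (b n)) * r\<^sup>2" for n
  proof (rule first_exit_cover[OF f r, where n = n and \<beta> = \<beta>])
    fix z assume z: "z \<in> N n"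
    define s where "s = norm ((f ^^ n) z)"
    have bs: "b n \<le> s" unfolding b_def s_def
      using z by (intro set_B_orbit_growth[OF \<beta>_pos \<beta>_incr r]) (auto simp: N_def K_def)
    have s: "r \<le> s" using bs rb[of n] by linarith
    have as: "\<alpha> s \<le> \<alpha> (b n)" using \<alpha>_decr bs rb[of n] r by (simp add: monotone_on_def)
    show "norm z < 2 * r" "(f ^^ n) z \<notin> set_B \<beta> f" "\<And>k. k < n \<Longrightarrow> (f ^^ k) z \<in> set_B \<beta> f"
      using z by (auto simp: N_def K_def)
    show "(f ^^ n) z \<noteq> 0" using s r by (auto simp: s_def)
    have s0: "0 < s" and s1: "\<alpha> s < 1" using s r as \<alpha>1[of n] by auto
    note m = annulus_minus_measure[OF s0 s1 dens[OF s]]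
    show "annulus (norm ((f ^^ n) z)) - set_B \<beta> f \<in> lmeasurable" using m(1) by (simp add: s_def)
    have "16 * \<alpha> s * s\<^sup>2 \<le> 16 * \<alpha> (b n) * s\<^sup>2" using as by (intro mult_right_mono) auto
    then show "measure lebesgue (annulus (norm ((f ^^ n) z)) - set_B \<beta> f) \<le> 16 * \<alpha> (b n) * (norm ((f ^^ n) z))\<^sup>2"
      using m(2) by (simp add: s_def)
  qed (use \<alpha>b in auto)
  then have "\<forall>n. \<exists>T. T \<in> lmeasurable \<and> N n \<subseteq> T \<and> measure lebesgue T \<le> 18662400 * (16 * \<alpha> (b n)) * r\<^sup>2" by blast
  from choice[OF this] obtain T where T: "\<And>n. T n \<in> lmeasurable" "\<And>n. N n \<subseteq> T n"
    "\<And>n. measure lebesgue (T n) \<le> 18662400 * (16 * \<alpha> (b n)) * r\<^sup>2"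
    by blast
  have bound: "measure lebesgue (\<Union>i\<le>n. T i) \<le> r\<^sup>2" for n
  proof -
    have "measure lebesgue (\<Union>i\<le>n. T i) \<le> (\<Sum>i\<le>n. measure lebesgue (T i))"
      using T(1) by (intro measure_UNION_le) (auto dest: fmeasurableD)
    also have "\<dots> \<le> (\<Sum>i\<le>n. 18662400 * (16 * \<alpha> (b i)) * r\<^sup>2)" using T(3) by (intro sum_mono) auto
    also have "\<dots> = (\<Sum>i\<le>n. 298598400 * r\<^sup>2 * \<alpha> (b i))" by (simp add: mult_ac)
    also have "\<dots> = 298598400 * r\<^sup>2 * (\<Sum>i\<le>n. \<alpha> (b i))" by (rule sum_distrib_left[symmetric])
    also have "(\<Sum>i\<le>n. \<alpha> (b i)) \<le> (\<Sum>i. \<alpha> (b i))"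
      using sum \<alpha>b by (intro sum_le_suminf) (auto simp: b_def less_imp_le)
    also have "\<dots> \<le> 1 / 10 ^ 9" using small by (simp add: b_def)
    finally have "measure lebesgue (\<Union>i\<le>n. T i) \<le> 298598400 * r\<^sup>2 * (1 / 10 ^ 9)"
      by (simp add: mult_left_mono)
    also have "\<dots> \<le> r\<^sup>2" by simp
    finally show ?thesis .
  qed
  have TU: "(\<Union>i. T i) \<in> lmeasurable" "measure lebesgue (\<Union>i. T i) \<le> r\<^sup>2"
    using fmeasurable_countable_Union[OF T(1) bound] measure_countable_Union_le[OF T(1) bound] by auto
  have Keq: "K = ball 0 (2 * r) - cball 0 r" by (auto simp: K_def)
  have KM: "K \<in> lmeasurable" unfolding Keq by (simp add: fmeasurable.Diff)
  have "measure lebesgue K = measure lebesgue (ball 0 (2 * r) :: complex set) - measure lebesgue (cball 0 r :: complex set)"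
    unfolding Keq using r by (intro measurable_measure_Diff) auto
  also have "\<dots> = pi * (3 * r\<^sup>2)"
    using r by (simp add: content_ball content_cball unit_ball_vol_2 power_mult_distrib)
  also have "\<dots> \<ge> 2 * (3 * r\<^sup>2)" using pi_ge_two by (intro mult_right_mono) auto
  finally have mK: "6 * r\<^sup>2 \<le> measure lebesgue K" by simp
  define S where "S = K - (\<Union>i. T i)"
  have "S \<in> lmeasurable" unfolding S_def using KM TU(1) by (rule fmeasurable.Diff)
  moreover have "0 < measure lebesgue S"
  proof -
    have "measure lebesgue K - measure lebesgue (\<Union>i. T i) \<le> measure lebesgue S"
      unfolding S_def using KM TU(1) by (rule measure_diff_le_measure_setdiff)
    moreover have "0 < r\<^sup>2" using r by simp
    ultimately show ?thesis using mK TU(2) by linarith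
  qed
  moreover have "r \<le> norm z \<and> (\<forall>k. (f ^^ k) z \<in> set_B \<beta> f)" if z: "z \<in> S" for z
  proof (rule ccontr)
    assume neg: "\<not> ?thesis"
    have zK: "z \<in> K" using z by (simp add: S_def)
    then have "\<exists>k. (f ^^ k) z \<notin> set_B \<beta> f" using neg by (auto simp: K_def)
    then obtain n where "(f ^^ n) z \<notin> set_B \<beta> f" "\<forall>k<n. (f ^^ k) z \<in> set_B \<beta> f"
      using exists_least_iff[of "\<lambda>k. (f ^^ k) z \<notin> set_B \<beta> f"] by auto
    then have "z \<in> N n" using zK by (simp add: N_def)
    then show False using T(2) z by (auto simp: S_def)
  qed
  ultimately show ?thesis by blast
qed

section \<open>Normality and uniform escape\<close>

definition escapes_uniformly_on :: "(complex \<Rightarrow> complex) \<Rightarrow> complex set \<Rightarrow> bool" where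
  "escapes_uniformly_on f K \<longleftrightarrow> (\<forall>M. \<forall>\<^sub>F n in sequentially. \<forall>z\<in>K. norm ((f ^^ n) z) > M)"

lemma escapes_uniformly_on_subset:
  assumes "escapes_uniformly_on f K" "K' \<subseteq> K"
  shows "escapes_uniformly_on f K'"
  unfolding escapes_uniformly_on_def
proof
  fix M
  have "\<forall>\<^sub>F n in sequentially. \<forall>z\<in>K. norm ((f ^^ n) z) > M"
    using assms(1) by (simp add: escapes_uniformly_on_def)
  then show "\<forall>\<^sub>F n in sequentially. \<forall>z\<in>K'. norm ((f ^^ n) z) > M"
    by (rule eventually_mono) (use assms(2) in blast)
qed

lemma escaping_set_iff: "z \<in> escaping_set f \<longleftrightarrow> escapes_uniformly_on f {z}"
  by (simp add: escaping_set_def escapes_uniformly_on_def filterlim_at_infinity_conv_norm_at_top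
      filterlim_at_top_dense)

text \<open>
Normality upgrades escape at one point to uniform escape: a sequence of iterates each of which
has modulus at most \<open>M\<close> somewhere on \<open>K\<close> would have a convergent subsequence; a finite limit is excluded at the
escaping point, and the limit infinity is excluded by \<open>M\<close>.
\<close>

lemma normal_family_escapes:
  assumes nf: "normal_family_on U (range (\<lambda>n. f ^^ n))" and y: "y \<in> U" "y \<in> escaping_set f"
    and K: "compact K" "K \<subseteq> U"
  shows "escapes_uniformly_on f K"
proof (rule ccontr)
  assume "\<not> escapes_uniformly_on f K"
  then obtain M where M: "\<exists>\<^sub>F n in sequentially. \<exists>z\<in>K. \<not> norm ((f ^^ n) z) > M"
    unfolding escapes_uniformly_on_def frequently_def by auto
  define A where "A = {n. \<exists>z\<in>K. \<not> norm ((f ^^ n) z) > M}"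
  have inf: "infinite A"
    using M unfolding A_def by (simp add: frequently_cofinite[symmetric] cofinite_eq_sequentially)
  define r where "r = enumerate A"
  have r: "strict_mono r" "\<And>n. r n \<in> A"
    using inf by (auto simp: r_def strict_mono_enumerate enumerate_in_set)
  define g where "g = (\<lambda>n. f ^^ (r n))"
  have "range g \<subseteq> range (\<lambda>n. f ^^ n)" by (auto simp: g_def)
  then obtain s where s: "strict_mono (s :: nat \<Rightarrow> nat)"
    and alt: "(\<exists>h. h holomorphic_on U \<and> (\<forall>K. compact K \<and> K \<subseteq> U \<longrightarrow>
                    uniform_limit K (\<lambda>n. g (s n)) h sequentially)) \<or>
            (\<forall>K. compact K \<and> K \<subseteq> U \<longrightarrow>
               (\<forall>M. \<forall>\<^sub>F n in sequentially. \<forall>z\<in>K. norm (g (s n) z) > M))"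
    using nf unfolding normal_family_on_def by meson
  from alt show False
  proof
    assume "\<exists>h. h holomorphic_on U \<and> (\<forall>K. compact K \<and> K \<subseteq> U \<longrightarrow>
                    uniform_limit K (\<lambda>n. g (s n)) h sequentially)"
    then obtain h where h: "\<forall>K. compact K \<and> K \<subseteq> U \<longrightarrow>
                    uniform_limit K (\<lambda>n. g (s n)) h sequentially" by blast
    have "compact {y} \<and> {y} \<subseteq> U" using y(1) by simp
    then have "uniform_limit {y} (\<lambda>n. g (s n)) h sequentially" using h by blast
    then have "(\<lambda>n. g (s n) y) \<longlonglongrightarrow> h y" by (rule tendsto_uniform_limitI) simp
    moreover have "strict_mono (\<lambda>n. r (s n))" using r(1) s by (simp add: strict_mono_def)
    then have "filterlim (\<lambda>n. r (s n)) sequentially sequentially" by (rule filterlim_subseq)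
    then have "filterlim (\<lambda>n. (f ^^ (r (s n))) y) at_infinity sequentially"
      using y(2) unfolding escaping_set_def by (auto intro: filterlim_compose)
    ultimately show False
      unfolding g_def using not_tendsto_and_filterlim_at_infinity[OF sequentially_bot] by blast
  next
    assume "\<forall>K. compact K \<and> K \<subseteq> U \<longrightarrow>
               (\<forall>M. \<forall>\<^sub>F n in sequentially. \<forall>z\<in>K. norm (g (s n) z) > M)"
    then have "\<forall>\<^sub>F n in sequentially. \<forall>z\<in>K. norm (g (s n) z) > M" using K by blast
    then obtain n where "\<forall>z\<in>K. norm (g (s n) z) > M" by (auto simp: eventually_sequentially)
    then show False using r(2)[of "s n"] by (auto simp: g_def A_def)
  qed
qed

text \<open>
A sequence of iterates either repeats one iterate infinitely often, or its indices tend to infinity.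
\<close>

lemma escapes_uniformly_imp_normal:
  assumes f: "f holomorphic_on UNIV" and esc: "escapes_uniformly_on f U"
  shows "normal_family_on U (range (\<lambda>n. f ^^ n))"
  unfolding normal_family_on_def
proof (intro allI impI)
  fix g :: "nat \<Rightarrow> complex \<Rightarrow> complex" assume "range g \<subseteq> range (\<lambda>n. f ^^ n)"
  then have "\<forall>n. \<exists>k. g n = f ^^ k" by blast
  then obtain m where m: "\<And>n. g n = f ^^ (m n)" by metis
  show "\<exists>s. strict_mono (s :: nat \<Rightarrow> nat) \<and>
       ((\<exists>h. h holomorphic_on U \<and> (\<forall>K. compact K \<and> K \<subseteq> U \<longrightarrow>
                    uniform_limit K (\<lambda>n. g (s n)) h sequentially)) \<or>
            (\<forall>K. compact K \<and> K \<subseteq> U \<longrightarrow>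
               (\<forall>M. \<forall>\<^sub>F n in sequentially. \<forall>z\<in>K. norm (g (s n) z) > M)))"
  proof (cases "\<exists>k. infinite {n. m n = k}")
    case True
    then obtain k where k: "infinite {n. m n = k}" by blast
    define s where "s = enumerate {n. m n = k}"
    have s: "strict_mono s" "\<And>n. m (s n) = k"
      using k enumerate_in_set[OF k] by (auto simp: s_def strict_mono_enumerate)
    have "(f ^^ k) holomorphic_on U" using funpow_holomorphic[OF f] holomorphic_on_subset by blast
    then show ?thesis using s by (intro exI[of _ s]) (auto simp: m intro!: exI[of _ "f ^^ k"] uniform_limit_const)
  next
    case False
    have "\<forall>\<^sub>F n in sequentially. k \<le> m n" for k
    proof -
      have "finite (\<Union>i\<le>k. {n. m n = i})" using False by auto
      moreover have "{n. \<not> k \<le> m n} \<subseteq> (\<Union>i\<le>k. {n. m n = i})" by auto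
      ultimately show ?thesis
        unfolding cofinite_eq_sequentially[symmetric] eventually_cofinite using finite_subset by blast
    qed
    then have lim: "filterlim m sequentially sequentially" by (simp add: filterlim_at_top)
    have "\<forall>\<^sub>F n in sequentially. \<forall>z\<in>K. norm (g n z) > M" if "K \<subseteq> U" for K M
    proof -
      have "\<forall>\<^sub>F n in sequentially. \<forall>z\<in>K. norm ((f ^^ n) z) > M"
        using escapes_uniformly_on_subset[OF esc that] by (simp add: escapes_uniformly_on_def)
      from eventually_compose_filterlim[OF this lim] show ?thesis by (simp add: m)
    qed
    then show ?thesis by (intro exI[of _ "\<lambda>n. n"]) (auto simp: strict_mono_def)
  qed
qed

lemma open_fatou_set: "open (fatou_set f)"
proof -
  have "fatou_set f = \<Union>{U. open U \<and> connected U \<and> normal_family_on U (range (\<lambda>n. f ^^ n))}"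
    by (auto simp: fatou_set_def)
  then show ?thesis by (metis (no_types, lifting) mem_Collect_eq open_Union)
qed

lemma escaping_set_borel:
  assumes f: "f holomorphic_on UNIV"
  shows "escaping_set f \<in> sets borel"
proof -
  have [measurable]: "(f ^^ n) \<in> borel_measurable borel" for n
    using funpow_holomorphic[OF f] 
    by (intro borel_measurable_continuous_onI holomorphic_on_imp_continuous_on)
  have "escaping_set f = {z \<in> space borel. \<forall>M::nat. \<exists>N. \<forall>n\<in>{N..}. real M \<le> norm ((f ^^ n) z)}"
  proof -
    have "filterlim g at_top sequentially \<longleftrightarrow> (\<forall>M::nat. \<exists>N. \<forall>n\<in>{N..}. real M \<le> g n)" for g :: "nat \<Rightarrow> real"
    proof
      assume "filterlim g at_top sequentially"
      then show "\<forall>M::nat. \<exists>N. \<forall>n\<in>{N..}. real M \<le> g n"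
        unfolding filterlim_at_top eventually_sequentially by (metis atLeast_iff)
    next
      assume *: "\<forall>M::nat. \<exists>N. \<forall>n\<in>{N..}. real M \<le> g n"
      show "filterlim g at_top sequentially"
        unfolding filterlim_at_top eventually_sequentially
      proof
        fix Z :: real
        obtain M :: nat where "Z \<le> real M" using real_arch_simple by blast
        with * show "\<exists>N. \<forall>n\<ge>N. Z \<le> g n" by (meson atLeast_iff order_trans)
      qed
    qed
    then show ?thesis
      by (simp add: escaping_set_def filterlim_at_infinity_conv_norm_at_top)
  qed
  also have "\<dots> \<in> sets borel" by measurable
  finally show ?thesis .
qed

text \<open>
Escaping and not escaping are both open conditions in the Fatou set, by normality on small neighbourhoods. So
one escaping point makes the whole component escape.
\<close>

lemma fatou_component_escapes:
  assumes U: "U \<in> components (fatou_set f)" and y: "y \<in> U" "y \<in> escaping_set f" and x: "x \<in> U"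
  obtains R where "0 < R" "cball x R \<subseteq> U" "escapes_uniformly_on f (cball x R)"
proof -
  have oU: "open U" using U open_components open_fatou_set by blast
  have UF: "U \<subseteq> fatou_set f" using U by (rule in_components_subset)
  have nb: "\<exists>V. open V \<and> a \<in> V \<and> V \<subseteq> U \<and> (\<forall>b\<in>V. \<forall>K. b \<in> escaping_set f \<longrightarrow> compact K \<longrightarrow> K \<subseteq> V \<longrightarrow> escapes_uniformly_on f K)"
    if a: "a \<in> U" for a
  proof -
    obtain V where V: "open V" "a \<in> V" "normal_family_on V (range (\<lambda>n. f ^^ n))"
      using a UF unfolding fatou_set_def by blast
    show ?thesis
      using V a oU normal_family_escapes[OF V(3)] by (intro exI[of _ "V \<inter> U"]) auto
  qed
  have "y \<in> escaping_set f \<longleftrightarrow> x \<in> escaping_set f"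
  proof (rule connected_equivalence_relation[of U y x "\<lambda>a b. a \<in> escaping_set f \<longleftrightarrow> b \<in> escaping_set f"])
    show "connected U" using U by (rule in_components_connected)
    fix a assume a: "a \<in> U"
    obtain V where V: "open V" "a \<in> V" "V \<subseteq> U"
      "\<And>b K. b \<in> V \<Longrightarrow> b \<in> escaping_set f \<Longrightarrow> compact K \<Longrightarrow> K \<subseteq> V \<Longrightarrow> escapes_uniformly_on f K"
      using nb[OF a] by blast
    have "a \<in> escaping_set f \<longleftrightarrow> b \<in> escaping_set f" if "b \<in> V" for b
      using V(4)[of a "{b}"] V(4)[of b "{a}"] V(2) that by (auto simp: escaping_set_iff)
    then show "\<exists>T. openin (top_of_set U) T \<and> a \<in> T \<and> (\<forall>x\<in>T. (a \<in> escaping_set f) = (x \<in> escaping_set f))"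
      using V by (intro exI[of _ V]) (auto intro: open_subset)
  qed (use y x in auto)
  then have xe: "x \<in> escaping_set f" using y by simp
  obtain V where V: "open V" "x \<in> V" "V \<subseteq> U"
      "\<And>b K. b \<in> V \<Longrightarrow> b \<in> escaping_set f \<Longrightarrow> compact K \<Longrightarrow> K \<subseteq> V \<Longrightarrow> escapes_uniformly_on f K"
    using nb[OF x] by blast
  obtain R where R: "0 < R" "cball x R \<subseteq> V" using V(1,2) open_contains_cball by blast
  show ?thesis using that[OF R(1)] R(2) V(3) V(4)[OF V(2) xe compact_cball R(2)] by blast
qed

text \<open>
The form of Harnack's inequality that is used for the iterates. The centre \<open>a\<close> may vary in a small disk, so
that the roles of \<open>a\<close> and \<open>b\<close> can be exchanged.
\<close>

lemma escapes_uniformly_Harnack: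
  assumes f: "f holomorphic_on UNIV" and R: "0 < R" and esc: "escapes_uniformly_on f (cball x R)"
  shows "\<forall>\<^sub>F n in sequentially. \<forall>a b. a \<in> cball x (R / 4) \<longrightarrow> norm (b - a) \<le> R / 4 \<longrightarrow>
           ln (norm ((f ^^ n) b)) \<le> 3 * ln (norm ((f ^^ n) a))"
proof -
  have "\<forall>\<^sub>F n in sequentially. \<forall>u\<in>cball x R. 1 < norm ((f ^^ n) u)"
    using esc by (simp add: escapes_uniformly_on_def)
  then show ?thesis
  proof (rule eventually_mono, intro allI impI)
    fix n a b assume n: "\<forall>u\<in>cball x R. 1 < norm ((f ^^ n) u)"
      and a: "a \<in> cball x (R / 4)" and b: "norm (b - a) \<le> R / 4"
    have sub: "ball a (R / 2) \<subseteq> cball x R"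
    proof
      fix u assume "u \<in> ball a (R / 2)"
      then show "u \<in> cball x R" using a dist_triangle[of x u a] R by simp
    qed
    show "ln (norm ((f ^^ n) b)) \<le> 3 * ln (norm ((f ^^ n) a))"
    proof (rule Harnack_log_norm[where g = "f ^^ n" and R = "R / 2"])
      show "(f ^^ n) holomorphic_on ball a (R / 2)"
        using funpow_holomorphic[OF f] holomorphic_on_subset by blast
    qed (use n sub b R in auto)
  qed
qed

text \<open>
Comparability of \<open>log \<bar>f\<^sup>n\<bar>\<close> is an equivalence relation between points whose classes are open by
Harnack's inequality; so there is only one class in a connected set.
\<close>

lemma fatou_component_log_comparable:
  assumes f: "f holomorphic_on UNIV" and U: "U \<in> components (fatou_set f)" 
    and y: "y \<in> U" "y \<in> escaping_set f" and ab: "a \<in> U" "b \<in> U"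
  shows "\<exists>C>0. \<forall>\<^sub>F n in sequentially. ln (norm ((f ^^ n) a)) \<le> C * ln (norm ((f ^^ n) b))"
proof -
  define P where "P = (\<lambda>a b. \<exists>C>0. \<forall>\<^sub>F n in sequentially. ln (norm ((f ^^ n) a)) \<le> C * ln (norm ((f ^^ n) b)))"
  have tr: "P a c" if ab: "P a b" and bc: "P b c" for a b c
  proof -
    obtain C1 where C1: "C1 > 0" "\<forall>\<^sub>F n in sequentially. ln (norm ((f ^^ n) a)) \<le> C1 * ln (norm ((f ^^ n) b))"
      using ab unfolding P_def by blast
    obtain C2 where C2: "C2 > 0" "\<forall>\<^sub>F n in sequentially. ln (norm ((f ^^ n) b)) \<le> C2 * ln (norm ((f ^^ n) c))"
      using bc unfolding P_def by blast
    have "\<forall>\<^sub>F n in sequentially. ln (norm ((f ^^ n) a)) \<le> (C1 * C2) * ln (norm ((f ^^ n) c))"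
      using C1(2) C2(2)
    proof eventually_elim
      case (elim n)
      have "C1 * ln (norm ((f ^^ n) b)) \<le> C1 * (C2 * ln (norm ((f ^^ n) c)))"
        using elim(2) C1(1) by (intro mult_left_mono) auto
      then show ?case using elim(1) by simp
    qed
    then show ?thesis unfolding P_def using C1(1) C2(1) by (intro exI[of _ "C1 * C2"]) simp
  qed
  have oU: "open U" using U open_components open_fatou_set by blast
  have "P a b \<and> P b a"
  proof (rule connected_equivalence_relation[of U a b "\<lambda>a b. P a b \<and> P b a"])
    show "connected U" using U by (rule in_components_connected)
    show "\<exists>T. openin (top_of_set U) T \<and> x \<in> T \<and> (\<forall>u\<in>T. P x u \<and> P u x)" if x: "x \<in> U" for x
    proof -
      obtain R where R: "0 < R" "cball x R \<subseteq> U" "escapes_uniformly_on f (cball x R)"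
        using fatou_component_escapes[OF U y x] .
      note H = escapes_uniformly_Harnack[OF f R(1,3)]
      have "P x u \<and> P u x" if u: "u \<in> ball x (R / 4)" for u
      proof
        have "\<forall>\<^sub>F n in sequentially. ln (norm ((f ^^ n) x)) \<le> 3 * ln (norm ((f ^^ n) u))"
          using H by (rule eventually_mono) (use u in \<open>auto simp: dist_norm\<close>)
        then show "P x u" unfolding P_def by (intro exI[of _ 3]) simp
        have "\<forall>\<^sub>F n in sequentially. ln (norm ((f ^^ n) u)) \<le> 3 * ln (norm ((f ^^ n) x))"
          using H by (rule eventually_mono) (use u R(1) in \<open>auto simp: dist_norm norm_minus_commute\<close>)
        then show "P u x" unfolding P_def by (intro exI[of _ 3]) simp
      qed
      moreover have "ball x (R / 4) \<subseteq> U" using R(1,2) by (auto simp: subset_iff)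
      ultimately show ?thesis using R(1)
        by (intro exI[of _ "ball x (R / 4)"]) (auto intro: open_subset)
    qed
  qed (use ab tr in blast)+
  then show ?thesis by (simp add: P_def)
qed

section \<open>Fatou components meeting an orbit in \<open>B\<close>\<close>

text \<open>
Liouville's theorem needs the growth bound only on a sequence of circles, since Cauchy's estimates do.
\<close>

lemma polynomial_growth_on_circles:
  fixes \<rho> :: "nat \<Rightarrow> real"
  assumes f: "f holomorphic_on UNIV" and \<rho>: "filterlim \<rho> at_top sequentially"
    and bd: "\<forall>\<^sub>F i in sequentially. \<forall>w. norm w = \<rho> i \<longrightarrow> norm (f w) \<le> \<rho> i ^ N"
  shows "\<exists>p. \<forall>z. f z = poly p z"
proof -
  have zero: "(deriv ^^ k) f 0 = 0" if k: "N < k" for k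
  proof -
    have "\<forall>\<^sub>F i in sequentially. norm ((deriv ^^ k) f 0) \<le> fact k / \<rho> i"
      using bd filterlim_at_top_dense[THEN iffD1, OF \<rho>, THEN spec, of 1]
    proof eventually_elim
      case (elim i)
      have "norm ((deriv ^^ k) f 0) \<le> fact k * \<rho> i ^ N / \<rho> i ^ k"
      proof (rule Cauchy_inequality)
        show "f holomorphic_on ball 0 (\<rho> i)" using f holomorphic_on_subset by blast
        show "continuous_on (cball 0 (\<rho> i)) f"
          using f holomorphic_on_imp_continuous_on continuous_on_subset by blast
      qed (use elim in auto)
      also have "\<dots> = fact k / \<rho> i ^ (k - N)"
        using k elim(2) by (simp add: power_diff)
      also have "\<dots> \<le> fact k / \<rho> i"
        using k elim(2) self_le_power[of "\<rho> i" "k - N"] by (intro divide_left_mono) auto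
      finally show ?case .
    qed
    moreover have "(\<lambda>i. fact k / \<rho> i) \<longlonglongrightarrow> 0"
      using \<rho> by (intro tendsto_divide_0[OF tendsto_const] filterlim_at_top_imp_at_infinity)
    ultimately have "norm ((deriv ^^ k) f 0) \<le> 0"
      using tendsto_le[OF sequentially_bot _ tendsto_const] by blast
    then show ?thesis by simp
  qed
  define c where "c = (\<lambda>k. (deriv ^^ k) f 0 / fact k)"
  have "f z = poly (\<Sum>k\<le>N. monom (c k) k) z" for z
  proof -
    have "(\<lambda>k. (deriv ^^ k) f 0 / fact k * (z - 0) ^ k) sums f z"
      by (rule holomorphic_power_series[where r = "norm z + 1"])
        (use f holomorphic_on_subset in auto)
    then have "(\<lambda>k. c k * z ^ k) sums f z" by (simp add: c_def)
    moreover have "(\<lambda>k. c k * z ^ k) sums (\<Sum>k\<le>N. c k * z ^ k)"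
      by (rule sums_finite) (use zero in \<open>auto simp: c_def\<close>)
    ultimately have "f z = (\<Sum>k\<le>N. c k * z ^ k)" by (rule sums_unique2)
    then show ?thesis by (simp add: poly_sum poly_monom)
  qed
  then show ?thesis by blast
qed

text \<open>
Suppose \<open>f\<^sup>n(u) = f\<^sup>k(v)\<close> with \<open>n < k\<close> and \<open>u\<close>, \<open>v\<close> in \<open>U\<close>. Then \<open>f\<^sup>m\<^sup>+\<^sup>n(u) = f\<^sup>m\<^sup>+\<^sup>k(v)\<close> for all
\<open>m\<close>, and comparing \<open>u\<close> and \<open>v\<close> with \<open>z\<close> gives \<open>log \<bar>f\<^sup>m\<^sup>+\<^sup>k(z)\<bar> \<le> C log \<bar>f\<^sup>m\<^sup>+\<^sup>n(z)\<bar>\<close>. As the moduli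
along the orbit increase, also \<open>log \<bar>f\<^sup>j\<^sup>+\<^sup>1(z)\<bar> \<le> C log \<bar>f\<^sup>j(z)\<bar>\<close> for all large \<open>j\<close>. Every point
\<open>\<zeta>\<close> on the circle through \<open>f\<^sup>j(z)\<close> is \<open>f\<^sup>j(a)\<close> with \<open>a\<close> close to \<open>z\<close>; so
\<open>log \<bar>f \<zeta>\<bar> = log \<bar>f\<^sup>j\<^sup>+\<^sup>1(a)\<bar> \<le> 3 log \<bar>f\<^sup>j\<^sup>+\<^sup>1(z)\<bar> \<le> 3 C log \<bar>\<zeta>\<bar>\<close>, and \<open>f\<close> would be a polynomial.
\<close>

lemma orbit_component_wandering:
  assumes f: "transcendental_entire f" and U: "U \<in> components (fatou_set f)" and z: "z \<in> U"
    and B: "\<And>k. (f ^^ k) z \<in> set_B \<beta> f" and esc: "z \<in> escaping_set f"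
    and mono: "\<And>k. norm ((f ^^ k) z) \<le> norm ((f ^^ Suc k) z)"
  shows "wandering_domain f U"
proof -
  have fh: "f holomorphic_on UNIV" and np: "\<not> (\<exists>p. \<forall>z. f z = poly p z)"
    using f by (auto simp: transcendental_entire_def)
  define w where "w = (\<lambda>k. (f ^^ k) z)"
  have wmono: "norm (w j) \<le> norm (w k)" if "j \<le> k" for j k
    using mono lift_Suc_mono_le[of "\<lambda>k. norm (w k)"] that by (simp add: w_def)
  have w_top: "filterlim (\<lambda>k. norm (w k)) at_top sequentially"
    using esc by (simp add: escaping_set_def w_def filterlim_at_infinity_conv_norm_at_top)
  have disj: "(f ^^ n) ` U \<inter> (f ^^ k) ` U = {}" if nk: "n < k" for n k
  proof (rule ccontr)
    assume "(f ^^ n) ` U \<inter> (f ^^ k) ` U \<noteq> {}"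
    then obtain u v where uv: "u \<in> U" "v \<in> U" "(f ^^ n) u = (f ^^ k) v" by blast
    obtain C1 where C1: "C1 > 0" "\<forall>\<^sub>F m in sequentially. ln (norm ((f ^^ m) z)) \<le> C1 * ln (norm ((f ^^ m) v))"
      using fatou_component_log_comparable[OF fh U z esc z uv(2)] by blast
    obtain C2 where C2: "C2 > 0" "\<forall>\<^sub>F m in sequentially. ln (norm ((f ^^ m) u)) \<le> C2 * ln (norm ((f ^^ m) z))"
      using fatou_component_log_comparable[OF fh U z esc uv(1) z] by blast
    have "\<forall>\<^sub>F m in sequentially. 1 < norm (w m)"
      using w_top by (simp add: filterlim_at_top_dense)
    then have big: "\<forall>\<^sub>F m in sequentially. 1 < norm (w (m + n))"
      by (rule eventually_compose_filterlim) (rule filterlim_add_const_nat_at_top)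
    have e1: "\<forall>\<^sub>F m in sequentially. ln (norm (w (m + k))) \<le> C1 * ln (norm ((f ^^ (m + k)) v))"
      unfolding w_def by (rule eventually_compose_filterlim[OF C1(2)]) (rule filterlim_add_const_nat_at_top)
    have e2: "\<forall>\<^sub>F m in sequentially. ln (norm ((f ^^ (m + n)) u)) \<le> C2 * ln (norm (w (m + n)))"
      unfolding w_def by (rule eventually_compose_filterlim[OF C2(2)]) (rule filterlim_add_const_nat_at_top)
    define C where "C = C1 * C2"
    have C0: "C > 0" using C1 C2 by (simp add: C_def)
    have "\<forall>\<^sub>F m in sequentially. 1 < norm (w (m + n)) \<and> ln (norm (w (Suc (m + n)))) \<le> C * ln (norm (w (m + n)))"
      using e1 e2 big
    proof eventually_elim
      case (elim m)
      have same: "(f ^^ (m + k)) v = (f ^^ (m + n)) u" using uv(3) by (simp add: funpow_add)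
      have "norm (w (m + n)) \<le> norm (w (Suc (m + n)))" "norm (w (Suc (m + n))) \<le> norm (w (m + k))"
        using nk by (auto intro: wmono)
      then have "ln (norm (w (Suc (m + n)))) \<le> ln (norm (w (m + k)))"
        using elim(3) by (subst ln_le_cancel_iff) linarith+
      also have "\<dots> \<le> C1 * ln (norm ((f ^^ (m + n)) u))" using elim(1) same by simp
      also have "\<dots> \<le> C1 * (C2 * ln (norm (w (m + n))))" using elim(2) C1(1) by (intro mult_left_mono) auto
      finally show ?case using elim(3) by (simp add: C_def)
    qed
    then obtain M where M: "\<And>m. m \<ge> M \<Longrightarrow> 1 < norm (w (m + n)) \<and> ln (norm (w (Suc (m + n)))) \<le> C * ln (norm (w (m + n)))"
      by (auto simp: eventually_sequentially)
    have growth: "\<forall>\<^sub>F i in sequentially. 1 < norm (w i) \<and> ln (norm (w (Suc i))) \<le> C * ln (norm (w i))"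
      unfolding eventually_sequentially
    proof (intro exI[of _ "M + n"] allI impI)
      fix i assume "M + n \<le> i"
      then show "1 < norm (w i) \<and> ln (norm (w (Suc i))) \<le> C * ln (norm (w i))"
        using M[of "i - n"] by simp
    qed
    obtain R where R: "0 < R" "cball z R \<subseteq> U" "escapes_uniformly_on f (cball z R)"
      using fatou_component_escapes[OF U z esc z] .
    have harnack: "\<forall>\<^sub>F i in sequentially. \<forall>a. norm (a - z) \<le> R / 4 \<longrightarrow>
           ln (norm ((f ^^ i) a)) \<le> 3 * ln (norm (w i))"
      using escapes_uniformly_Harnack[OF fh R(1,3)]
      by (rule eventually_mono) (use R(1) in \<open>auto simp: w_def\<close>)
    have "(\<lambda>i. 1 / 2 / 10 ^ i * norm z) \<longlonglongrightarrow> 0"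
      by (intro tendsto_mult_left_zero LIMSEQ_divide_realpow_zero) simp
    then have small: "\<forall>\<^sub>F i in sequentially. 1 / 2 / 10 ^ i * norm z < R / 4"
      using R(1) by (intro order_tendstoD(2)) auto
    define N where "N = nat \<lceil>3 * C\<rceil>"
    have NC: "3 * C \<le> real N" unfolding N_def by linarith
    have "\<forall>\<^sub>F i in sequentially. \<forall>\<zeta>. norm \<zeta> = norm (w (Suc i)) \<longrightarrow> norm (f \<zeta>) \<le> norm (w (Suc i)) ^ N"
      using small eventually_compose_filterlim[OF growth filterlim_Suc]
        eventually_compose_filterlim[OF harnack filterlim_compose[OF filterlim_Suc filterlim_Suc]]
    proof eventually_elim
      case (elim i)
      show ?case
      proof (intro allI impI)
        fix \<zeta> :: complex assume \<zeta>: "norm \<zeta> = norm (w (Suc i))"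
        then have "norm \<zeta> = norm ((f ^^ Suc i) z)" by (simp add: w_def)
        then obtain a where a: "(f ^^ Suc i) a = \<zeta>" "norm (a - z) < 1 / 2 / 10 ^ i * norm z"
          using set_B_iterate_circle[OF fh] B by blast
        have W1: "1 < norm (w (Suc i))" using elim(2) by blast
        have fa: "f \<zeta> = (f ^^ Suc (Suc i)) a" using a(1) by simp
        have "ln (norm (f \<zeta>)) \<le> 3 * ln (norm (w (Suc (Suc i))))"
          unfolding fa using elim(1,3) a(2) by (meson less_imp_le order.trans)
        also have "\<dots> \<le> 3 * (C * ln (norm (w (Suc i))))" using elim(2) by simp
        also have "\<dots> = (3 * C) * ln (norm (w (Suc i)))" by simp
        also have "\<dots> \<le> real N * ln (norm (w (Suc i)))"
          using NC W1 by (intro mult_right_mono) (auto simp: ln_gt_zero less_imp_le)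
        also have "\<dots> = ln (norm (w (Suc i)) ^ N)" using W1 by (subst ln_realpow) auto
        finally have le: "ln (norm (f \<zeta>)) \<le> ln (norm (w (Suc i)) ^ N)" .
        show "norm (f \<zeta>) \<le> norm (w (Suc i)) ^ N"
        proof (cases "f \<zeta> = 0")
          case False
          have "0 < norm (w (Suc i)) ^ N" using W1 by (intro zero_less_power) linarith
          then show ?thesis using le False by (subst (asm) ln_le_cancel_iff) auto
        qed simp
      qed
    qed
    moreover have "filterlim (\<lambda>i. norm (w (Suc i))) at_top sequentially"
      using w_top filterlim_compose[OF _ filterlim_Suc] by blast
    ultimately have "\<exists>p. \<forall>z. f z = poly p z"
      using polynomial_growth_on_circles[OF fh, of "\<lambda>i. norm (w (Suc i))" N] by blast
    then show False using np by simp
  qed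
  have "(f ^^ n) ` U \<inter> (f ^^ k) ` U = {}" if "n \<noteq> k" for n k
    using disj[of n k] disj[of k n] that by (cases "n < k") (auto simp: Int_commute)
  then show ?thesis using U by (simp add: wandering_domain_def)
qed

text \<open>
Otherwise the circle would have winding number \<open>1\<close> around a point outside a simply connected set.
\<close>

lemma zero_in_simply_connected_around_circle:
  assumes S: "simply_connected S" and r: "0 < r" and c: "\<And>w. norm w = r \<Longrightarrow> w \<in> S"
  shows "(0::complex) \<in> S"
proof (rule ccontr)
  assume "0 \<notin> S"
  moreover have "path_image (circlepath 0 r) \<subseteq> S" using c r by auto
  ultimately have "winding_number (circlepath 0 r) 0 = 0"
    by (intro simply_connected_imp_winding_number_zero[OF S]) auto
  moreover have "winding_number (circlepath 0 r) 0 = 1"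
    using r by (intro winding_number_circlepath) auto
  ultimately show False by simp
qed

text \<open>
If \<open>z\<close> had a neighbourhood \<open>ball z R\<close> of uniform escape, the images \<open>V n\<close> of this disk would be open
connected subsets of the Fatou set, and for large \<open>n\<close> they would contain the circle through \<open>f\<^sup>n(z)\<close> around
\<open>0\<close>. So would the components \<open>U n\<close>. These are wandering, hence simply connected, hence contain \<open>0\<close>,
and two successive ones coincide, which is impossible for a wandering domain.
\<close>

lemma orbit_in_julia_set:
  assumes f: "transcendental_entire f" 
    and nomc: "\<nexists>U. wandering_domain f U \<and> multiply_connected U"
    and B: "\<And>k. (f ^^ k) z \<in> set_B \<beta> f" and esc: "z \<in> escaping_set f"
    and mono: "\<And>k. norm ((f ^^ k) z) \<le> norm ((f ^^ Suc k) z)"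
  shows "z \<in> julia_set f"
proof (rule ccontr)
  assume "z \<notin> julia_set f"
  then have zF: "z \<in> fatou_set f" by (simp add: julia_set_def)
  have fh: "f holomorphic_on UNIV" using f by (auto simp: transcendental_entire_def)
  define w where "w = (\<lambda>k. (f ^^ k) z)"
  define U where "U = (\<lambda>n. connected_component_set (fatou_set f) (w n))"
  have orbit: "(f ^^ k) (w n) = w (k + n)" for k n by (simp add: w_def funpow_add)
  have "connected_component_set (fatou_set f) z \<in> components (fatou_set f)"
    using zF by (rule componentsI)
  moreover have "z \<in> connected_component_set (fatou_set f) z" using zF by simp
  ultimately obtain R where R: "0 < R" "escapes_uniformly_on f (cball z R)"
    using fatou_component_escapes[of _ f z z] esc by metis
  define V where "V = (\<lambda>n. (f ^^ n) ` ball z R)"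
  have wV: "w n \<in> V n" for n using R(1) by (auto simp: V_def w_def)
  have VF: "V n \<subseteq> fatou_set f" for n
  proof -
    have hol: "(f ^^ n) holomorphic_on ball z R"
      using funpow_holomorphic[OF fh] holomorphic_on_subset by blast
    have "\<not> (f ^^ n) constant_on ball z R"
    proof (rule nonzero_deriv_nonconstant)
      show "((f ^^ n) has_field_derivative deriv (f ^^ n) z) (at z)"
        using R(1) by (intro holomorphic_derivI[OF hol]) auto
      show "deriv (f ^^ n) z \<noteq> 0"
        using set_B_iterate(1)[OF fh _ refl refl, of n z] B by blast
    qed (use R(1) in auto)
    then have "open (V n)"
      unfolding V_def using open_mapping_thm[OF hol open_ball connected_ball open_ball subset_refl] by blast
    moreover have conn: "connected (V n)"
      unfolding V_def using hol by (intro connected_continuous_image holomorphic_on_imp_continuous_on) auto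
    moreover have "escapes_uniformly_on f (V n)"
      unfolding escapes_uniformly_on_def
    proof
      fix M
      have "\<forall>\<^sub>F m in sequentially. \<forall>u\<in>cball z R. M < norm ((f ^^ m) u)"
        using R(2) by (simp add: escapes_uniformly_on_def)
      then have "\<forall>\<^sub>F m in sequentially. \<forall>u\<in>cball z R. M < norm ((f ^^ (m + n)) u)"
        by (rule eventually_compose_filterlim) (rule filterlim_add_const_nat_at_top)
      then show "\<forall>\<^sub>F m in sequentially. \<forall>u\<in>V n. M < norm ((f ^^ m) u)"
        by (rule eventually_mono) (auto simp: V_def funpow_add)
    qed
    then have "normal_family_on (V n) (range (\<lambda>n. f ^^ n))"
      by (rule escapes_uniformly_imp_normal[OF fh])
    ultimately show ?thesis unfolding fatou_set_def by blast
  qed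
  have Vconn: "connected (V n)" for n
    unfolding V_def using funpow_holomorphic[OF fh, of n] holomorphic_on_subset
    by (intro connected_continuous_image holomorphic_on_imp_continuous_on) blast+
  have VU: "V n \<subseteq> U n" for n
    unfolding U_def by (rule connected_component_maximal[OF wV Vconn VF])
  have comp: "U n \<in> components (fatou_set f)" for n
    unfolding U_def using wV VF by (intro componentsI) blast
  have wU: "w n \<in> U n" for n using wV VU by blast
  have wand: "wandering_domain f (U n)" for n
  proof (rule orbit_component_wandering[OF f comp wU])
    show "(f ^^ k) (w n) \<in> set_B \<beta> f" for k
      unfolding orbit using B by (simp add: w_def)
    show "norm ((f ^^ k) (w n)) \<le> norm ((f ^^ Suc k) (w n))" for k
      unfolding orbit using mono[of "k + n"] by (simp add: w_def)
    have "filterlim (\<lambda>k. w (k + n)) at_infinity sequentially"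
      using esc filterlim_compose[OF _ filterlim_add_const_nat_at_top]
      unfolding escaping_set_def w_def by blast
    then show "w n \<in> escaping_set f" by (simp add: escaping_set_def orbit)
  qed
  have "(\<lambda>i. 1 / 2 / 10 ^ i * norm z) \<longlonglongrightarrow> 0"
    by (intro tendsto_mult_left_zero LIMSEQ_divide_realpow_zero) simp
  then have "\<forall>\<^sub>F i in sequentially. 1 / 2 / 10 ^ i * norm z < R"
    using R(1) by (intro order_tendstoD(2)) auto
  then obtain m where m: "\<And>i. i \<ge> m \<Longrightarrow> 1 / 2 / 10 ^ i * norm z < R"
    by (auto simp: eventually_sequentially)
  have zero: "0 \<in> U (Suc i)" if i: "i \<ge> m" for i
  proof (rule zero_in_simply_connected_around_circle)
    show "simply_connected (U (Suc i))"
      using nomc wand[of "Suc i"] in_components_connected[OF comp[of "Suc i"]]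
      by (auto simp: multiply_connected_def)
    show "0 < norm (w (Suc i))" using set_B_basic(3)[OF B] by (simp add: w_def del: funpow.simps)
    show "\<zeta> \<in> U (Suc i)" if "norm \<zeta> = norm (w (Suc i))" for \<zeta> :: complex
    proof -
      from that have "norm \<zeta> = norm ((f ^^ Suc i) z)" by (simp add: w_def)
      then obtain a where a: "(f ^^ Suc i) a = \<zeta>" "norm (a - z) < 1 / 2 / 10 ^ i * norm z"
        using set_B_iterate_circle[OF fh] B by blast
      have "a \<in> ball z R" using a(2) m[OF i] by (simp add: dist_norm norm_minus_commute)
      then have "\<zeta> \<in> V (Suc i)" using a(1) unfolding V_def by blast
      then show ?thesis using VU by blast
    qed
  qed
  have "U (Suc m) \<inter> U (Suc (Suc m)) \<noteq> {}"
    using zero[of m] zero[of "Suc m"] by auto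
  then have "U (Suc m) = U (Suc (Suc m))"
    by (rule iffD2[OF components_eq[OF comp comp]])
  then have "w (Suc (Suc m)) \<in> (f ^^ 0) ` U (Suc m)" using wU[of "Suc (Suc m)"] by simp
  moreover have "w (Suc (Suc m)) \<in> (f ^^ 1) ` U (Suc m)" using wU[of "Suc m"] by (auto simp: w_def)
  ultimately have "(f ^^ 0) ` U (Suc m) \<inter> (f ^^ 1) ` U (Suc m) \<noteq> {}" by blast
  moreover have "(f ^^ 0) ` U (Suc m) \<inter> (f ^^ 1) ` U (Suc m) = {}"
    using wand[of "Suc m"] unfolding wandering_domain_def by (metis zero_neq_one)
  ultimately show False by contradiction
qed

section \<open>Escaping points of positive measure\<close>

theorem theorem1p4:
  fixes f :: "complex \<Rightarrow> complex" and \<alpha> \<beta> :: "real \<Rightarrow> real"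
  assumes \<beta>_pos: "\<forall>x>0. \<beta> x > 0"
    and \<beta>_cont: "continuous_on {0<..} \<beta>"
    and \<beta>_incr: "mono_on {0<..} \<beta>"
    and \<beta>_gt: "\<exists>x0. \<forall>x>0. x > x0 \<longrightarrow> \<beta> x > x"
    and f: "transcendental_entire f"
    and \<alpha>_pos: "\<forall>x>0. \<alpha> x > 0"
    and \<alpha>_cont: "continuous_on {0<..} \<alpha>"
    and \<alpha>_decr: "antimono_on {0<..} \<alpha>"
    and \<alpha>_lim: "(\<alpha> \<longlongrightarrow> 0) at_top"
    and \<alpha>_sum: "\<exists>r0>0. summable (\<lambda>n. \<alpha> ((\<beta> ^^ n) r0))"
    and dens: "\<forall>\<^sub>F r in at_top.
      dens (set_B \<beta> f) {z. r / 2 < norm z \<and> norm z < 2 * r} \<ge> 1 - \<alpha> r"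
  shows "emeasure lebesgue (escaping_set f) > 0 \<and>
    ((\<nexists>U. wandering_domain f U \<and> multiply_connected U) \<longrightarrow>
      emeasure lebesgue (escaping_set f \<inter> julia_set f) > 0)"
proof -
  have fh: "f holomorphic_on UNIV" using f by (simp add: transcendental_entire_def)
  obtain x0 where x0: "\<And>x. x > 0 \<Longrightarrow> x > x0 \<Longrightarrow> x < \<beta> x" using \<beta>_gt by blast
  obtain r0 where r0: "0 < r0" "summable (\<lambda>n. \<alpha> ((\<beta> ^^ n) r0))" using \<alpha>_sum by blast
  note it = iterates_tendsto_infinity[OF \<beta>_pos \<beta>_incr \<alpha>_pos \<alpha>_decr r0]
  obtain s0 where s0: "\<And>s. s \<ge> s0 \<Longrightarrow> 1 - \<alpha> s \<le> dens (set_B \<beta> f) (annulus s)"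
    using dens unfolding annulus_def eventually_at_top_linorder by blast
  obtain N1 where N1: "\<And>n. n \<ge> N1 \<Longrightarrow> norm (\<Sum>i. \<alpha> ((\<beta> ^^ (i + n)) r0)) < 1 / 10 ^ 9"
    using suminf_exist_split[OF _ r0(2), of "1 / 10 ^ 9"] by auto
  have "\<forall>\<^sub>F n in sequentially. max x0 s0 < (\<beta> ^^ n) r0"
    using it(3) unfolding filterlim_at_top_dense by blast
  then obtain N2 where N2: "\<And>n. n \<ge> N2 \<Longrightarrow> max x0 s0 < (\<beta> ^^ n) r0"
    by (auto simp: eventually_sequentially)
  \<comment> \<open>start so late in the orbit of \<open>r0\<close> that the tail of the series is small\<close>
  define N where "N = max N1 N2"
  define r where "r = (\<beta> ^^ N) r0"
  have br: "(\<beta> ^^ n) r = (\<beta> ^^ (n + N)) r0" for n by (simp add: r_def funpow_add)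
  have r: "0 < r" "x0 < r" "s0 < r" using it(1) N2[of N] by (auto simp: r_def N_def)
  have sum: "summable (\<lambda>n. \<alpha> ((\<beta> ^^ n) r))"
    unfolding br using r0(2) by (subst summable_iff_shift)
  have small: "(\<Sum>n. \<alpha> ((\<beta> ^^ n) r)) < 1 / 10 ^ 9"
    unfolding br using N1[of N] by (simp add: N_def)
  have inc: "incseq (\<lambda>n. (\<beta> ^^ n) r)"
    unfolding br using it(2) by (simp add: incseq_def)
  have top: "filterlim (\<lambda>n. (\<beta> ^^ n) r) at_top sequentially"
    unfolding br using filterlim_compose[OF it(3) filterlim_add_const_nat_at_top] .
  obtain S where S: "S \<in> lmeasurable" "0 < measure lebesgue S"
    "\<And>z. z \<in> S \<Longrightarrow> r \<le> norm z" "\<And>z k. z \<in> S \<Longrightarrow> (f ^^ k) z \<in> set_B \<beta> f"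
    using set_B_orbits_positive_measure[OF fh \<beta>_pos \<beta>_incr \<alpha>_pos \<alpha>_decr r(1) sum small inc s0] r(3)
    by force
  have grow: "(\<beta> ^^ k) r \<le> norm ((f ^^ k) z)" if "z \<in> S" for z k
    using S(3,4) that by (intro set_B_orbit_growth[OF \<beta>_pos \<beta>_incr r(1)]) auto
  have esc: "z \<in> escaping_set f" if z: "z \<in> S" for z
    unfolding escaping_set_def filterlim_at_infinity_conv_norm_at_top mem_Collect_eq
    by (rule filterlim_at_top_mono[OF top]) (use grow[OF z] in simp)
  have mono: "norm ((f ^^ k) z) \<le> norm ((f ^^ Suc k) z)" if z: "z \<in> S" for z k
  proof -
    have "r \<le> (\<beta> ^^ k) r" using incseqD[OF inc, of 0 k] by simp
    then have "r \<le> norm ((f ^^ k) z)" using grow[OF z, of k] by linarith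
    then have "norm ((f ^^ k) z) < \<beta> (norm ((f ^^ k) z))" using r by (intro x0) auto
    then show ?thesis using set_B_basic(5)[OF S(4)[OF z, of k]] by simp
  qed
  have Spos: "0 < emeasure lebesgue S" using S(1,2) by (simp add: emeasure_eq_measure2)
  have escm: "escaping_set f \<in> sets lebesgue"
    using escaping_set_borel[OF fh] by (simp add: sets_completionI_sets)
  have "emeasure lebesgue S \<le> emeasure lebesgue (escaping_set f)"
    using esc escm by (intro emeasure_mono) auto
  then have 1: "0 < emeasure lebesgue (escaping_set f)" using Spos by (rule less_le_trans[rotated])
  have 2: "0 < emeasure lebesgue (escaping_set f \<inter> julia_set f)"
    if nomc: "\<nexists>U. wandering_domain f U \<and> multiply_connected U"
  proof -
    have "closed (julia_set f)" unfolding julia_set_def using open_fatou_set by blast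
    then have "julia_set f \<in> sets lebesgue" by (simp add: borel_closed sets_completionI_sets)
    then have "emeasure lebesgue S \<le> emeasure lebesgue (escaping_set f \<inter> julia_set f)"
      using esc escm orbit_in_julia_set[OF f nomc S(4) esc mono] by (intro emeasure_mono) auto
    then show ?thesis using Spos by (rule less_le_trans[rotated])
  qed
  show ?thesis using 1 2 by blast
qed

end
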